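(* Let $G$ be a finite almost simple group, let $K$ be a $2$-closed group with $G^*\le K\le\mathrm{Sym}(G)$, and let $\mathfrak U,\mathfrak L$ be the partitions associated with the principal $K$-section of $G$. Then the orbits of $K_{\mathfrak L}$ on $G\times G$ (componentwise action) are exactly the orbits contained in $Y\times Y$ for some $Y\in\mathfrak U$ together with all sets $\Delta\times\Delta'$ where $\Delta,\Delta'$ are orbits of $K_{\mathfrak L}$ on $G$ lying in distinct blocks of $\mathfrak U$ (i.e. the coherent configuration of orbits of $K_{\mathfrak L}$ is the direct sum of its restrictions to the blocks $Y\in\mathfrak U$). In particular $K_{\mathfrak L}=\prod_{Y\in\mathfrak U}(K_{\mathfrak L})^Y$, so $K$ is a generalized wreath product.
   Context: $G$ is almost simple if $\mathrm{soc}(G)$ is a nonabelian simple group. For $L\le G$, $L_{left}$, $L_{right}$ are the groups of permutations $g\mapsto xg$, $g\mapsto gx$ ($x\in L$) of $G$, and $L^*=L_{left}L_{right}$. $K$ is $2$-closed if every permutation preserving each orbit of $K$ on $G\times G$ lies in $K$. For an imprimitivity system $\mathfrak L$ of $K$, $K_{\mathfrak L}$ is the subgroup of $K$ fixing each block of $\mathfrak L$ setwise; for a union $Z$ of blocks, $(K_{\mathfrak L})^Z$ is the group induced by $K_{\mathfrak L}$ on $Z$; $\prod_{Y\in\mathfrak U}(K_{\mathfrak L})^Y$ denotes the group of all permutations whose restriction to each $Y$ lies in $(K_{\mathfrak L})^Y$. Principal section: the minimal block $L$ of $K$ is the intersection of all blocks of imprimitivity of $K$ that contain $1\in G$ and have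 more than one element (it is a $K$-block and a normal subgroup of $G$); $\mathfrak L$ is the imprimitivity system of $K$ containing $L$ (its blocks are the cosets of $L$). For $X,X'\in\mathfrak L$ write $X\sim X'$ if both restriction homomorphisms $(K_{\mathfrak L})^{X\cup X'}\to(K_{\mathfrak L})^X$ and $(K_{\mathfrak L})^{X\cup X'}\to(K_{\mathfrak L})^{X'}$ are isomorphisms; this is an equivalence relation. $U$ is the union of the $\sim$-class of $L$; it is a $K$-block and a normal subgroup with $L\trianglelefteq U\trianglelefteq G$, and $\mathfrak U$ is the imprimitivity system of $K$ containing $U$. $U/L$ is called the principal $K$-section of $G$ and $\mathfrak U,\mathfrak L$ the associated partitions. A generalized wreath product is a transitive group $K$ with imprimitivity systems $\mathfrak L,\mathfrak U$, each block of $\mathfrak L$ inside a block of $\mathfrak U$, and $K_{\mathfrak L}=\prod_{Y\in\mathfrak U}(K_{\mathfrak L})^Y$. *)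

theory Defs
  imports
    "HOL-Algebra.Group_Action"
    "HOL-Algebra.SimpleGroups"
    "HOL-Algebra.Generated_Groups"
    "HOL-Library.Disjoint_Sets"
begin

definition minimal_normal :: "('a, 'b) monoid_scheme \<Rightarrow> 'a set \<Rightarrow> bool" where
  "minimal_normal G N \<longleftrightarrow>
     N \<lhd> G \<and> N \<noteq> {\<one>\<^bsub>G\<^esub>} \<and> (\<forall>M. M \<lhd> G \<and> M \<subseteq> N \<and> M \<noteq> {\<one>\<^bsub>G\<^esub>} \<longrightarrow> M = N)"

definition socle :: "('a, 'b) monoid_scheme \<Rightarrow> 'a set" where
  "socle G = generate G (\<Union>{N. minimal_normal G N})"

definition almost_simple :: "('a, 'b) monoid_scheme \<Rightarrow> bool" where
  "almost_simple G \<longleftrightarrow>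
     group G \<and> simple_group (G\<lparr>carrier := socle G\<rparr>) \<and> \<not> comm_group (G\<lparr>carrier := socle G\<rparr>)"

text \<open>Permutations of a set \<open>S\<close> are the extensional bijections in \<^term>\<open>Bij S\<close>. A permutation group
  is given by its underlying set \<open>K\<close>, a subgroup of \<^term>\<open>BijGroup S\<close>.\<close>

abbreviation perm_group :: "'a set \<Rightarrow> ('a \<Rightarrow> 'a) set \<Rightarrow> ('a \<Rightarrow> 'a) monoid" where
  "perm_group S K \<equiv> (BijGroup S)\<lparr>carrier := K\<rparr>"

definition left_translations :: "('a, 'b) monoid_scheme \<Rightarrow> 'a set \<Rightarrow> ('a \<Rightarrow> 'a) set" where
  "left_translations G L = {\<lambda>g\<in>carrier G. x \<otimes>\<^bsub>G\<^esub> g | x. x \<in> L}"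

definition right_translations :: "('a, 'b) monoid_scheme \<Rightarrow> 'a set \<Rightarrow> ('a \<Rightarrow> 'a) set" where
  "right_translations G L = {\<lambda>g\<in>carrier G. g \<otimes>\<^bsub>G\<^esub> x | x. x \<in> L}"

definition two_sided_translations :: "('a, 'b) monoid_scheme \<Rightarrow> 'a set \<Rightarrow> ('a \<Rightarrow> 'a) set" where
  "two_sided_translations G L =
     left_translations G L <#>\<^bsub>BijGroup (carrier G)\<^esub> right_translations G L"

definition point_orbits :: "'a set \<Rightarrow> ('a \<Rightarrow> 'a) set \<Rightarrow> 'a set set" where
  "point_orbits S K = orbits (perm_group S K) S (\<lambda>f. f)"

definition pair_orbits :: "'a set \<Rightarrow> ('a \<Rightarrow> 'a) set \<Rightarrow> ('a \<times> 'a) set set" where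
  "pair_orbits S K = orbits (perm_group S K) (S \<times> S) (\<lambda>f. map_prod f f)"

definition two_closed :: "'a set \<Rightarrow> ('a \<Rightarrow> 'a) set \<Rightarrow> bool" where
  "two_closed S K \<longleftrightarrow>
     (\<forall>f \<in> Bij S. (\<forall>R \<in> pair_orbits S K. map_prod f f ` R = R) \<longrightarrow> f \<in> K)"

text \<open>The trivial blocks (singletons and the whole set) count as blocks of imprimitivity.\<close>

definition imprimitivity_block :: "'a set \<Rightarrow> ('a \<Rightarrow> 'a) set \<Rightarrow> 'a set \<Rightarrow> bool" where
  "imprimitivity_block S K B \<longleftrightarrow>
     B \<subseteq> S \<and> B \<noteq> {} \<and> (\<forall>f\<in>K. f ` B = B \<or> f ` B \<inter> B = {})"

definition imprimitivity_system :: "'a set \<Rightarrow> ('a \<Rightarrow> 'a) set \<Rightarrow> 'a set set \<Rightarrow> bool" where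
  "imprimitivity_system S K P \<longleftrightarrow> partition_on S P \<and> (\<forall>f\<in>K. \<forall>X\<in>P. f ` X \<in> P)"

definition system_of_block :: "('a \<Rightarrow> 'a) set \<Rightarrow> 'a set \<Rightarrow> 'a set set" where
  "system_of_block K B = {f ` B | f. f \<in> K}"

text \<open>For transitive \<open>K\<close>, \<open>system_of_block K B\<close> is the only imprimitivity system that can contain \<open>B\<close>.\<close>

lemma imprimitivity_system_unique:
  assumes "transitive_action (perm_group S K) S (\<lambda>f. f)"
    and "imprimitivity_system S K P" and "B \<in> P"
  shows "P = system_of_block K B"
proof
  show "system_of_block K B \<subseteq> P"
    using assms(2,3) by (auto simp: system_of_block_def imprimitivity_system_def)
  show "P \<subseteq> system_of_block K B"
  proof
    fix X assume X: "X \<in> P"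
    have part: "partition_on S P" using assms(2) by (simp add: imprimitivity_system_def)
    obtain x b where x: "x \<in> X" "x \<in> S" and b: "b \<in> B" "b \<in> S"
      using part X assms(3) unfolding partition_on_def by (metis UnionI all_not_in_conv)
    obtain f where f: "f \<in> K" "f b = x"
      using transitive_action.unique_orbit[OF assms(1) b(2) x(2)] by auto
    have "f ` B \<in> P" using assms(2,3) f(1) by (simp add: imprimitivity_system_def)
    moreover have "x \<in> f ` B" using f(2) b(1) by blast
    ultimately have "f ` B = X"
      using part X x(1) unfolding partition_on_def disjoint_def by blast
    then show "X \<in> system_of_block K B" using f(1) by (auto simp: system_of_block_def)
  qed
qed

definition blockwise_stabilizer :: "('a \<Rightarrow> 'a) set \<Rightarrow> 'a set set \<Rightarrow> ('a \<Rightarrow> 'a) set" where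
  "blockwise_stabilizer K P = {f\<in>K. \<forall>X\<in>P. f ` X = X}"

definition induced :: "('a \<Rightarrow> 'a) set \<Rightarrow> 'a set \<Rightarrow> ('a \<Rightarrow> 'a) set" where
  "induced H Z = (\<lambda>f. restrict f Z) ` H"

definition blockwise_product :: "'a set \<Rightarrow> ('a \<Rightarrow> 'a) set \<Rightarrow> 'a set set \<Rightarrow> ('a \<Rightarrow> 'a) set" where
  "blockwise_product S H P = {f \<in> Bij S. \<forall>Y\<in>P. restrict f Y \<in> induced H Y}"

text \<open>With \<open>H = K\<^sub>\<LL>\<close>, the relation \<open>X \<sim> X'\<close> on blocks of \<open>\<LL>\<close>.\<close>

definition linked_blocks :: "('a \<Rightarrow> 'a) set \<Rightarrow> 'a set \<Rightarrow> 'a set \<Rightarrow> bool" where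
  "linked_blocks H X X' \<longleftrightarrow>
     (\<lambda>f. restrict f X) \<in> iso (perm_group (X \<union> X') (induced H (X \<union> X'))) (perm_group X (induced H X)) \<and>
     (\<lambda>f. restrict f X') \<in> iso (perm_group (X \<union> X') (induced H (X \<union> X'))) (perm_group X' (induced H X'))"

definition minimal_block :: "('a, 'b) monoid_scheme \<Rightarrow> ('a \<Rightarrow> 'a) set \<Rightarrow> 'a set" where
  "minimal_block G K = \<Inter>{B. imprimitivity_block (carrier G) K B \<and> \<one>\<^bsub>G\<^esub> \<in> B \<and> B \<noteq> {\<one>\<^bsub>G\<^esub>}}"

text \<open>The principal section is \<open>U/L\<close> with \<open>L = minimal_block G K\<close> and \<open>U = section_top G K\<close>; its
  associated partitions \<open>\<LL>\<close> and \<open>\<UU>\<close> are \<open>lower_partition G K\<close> and \<open>upper_partition G K\<close>.\<close>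

definition lower_partition :: "('a, 'b) monoid_scheme \<Rightarrow> ('a \<Rightarrow> 'a) set \<Rightarrow> 'a set set" where
  "lower_partition G K = system_of_block K (minimal_block G K)"

definition section_top :: "('a, 'b) monoid_scheme \<Rightarrow> ('a \<Rightarrow> 'a) set \<Rightarrow> 'a set" where
  "section_top G K =
     \<Union>{X \<in> lower_partition G K.
         linked_blocks (blockwise_stabilizer K (lower_partition G K)) (minimal_block G K) X}"

definition upper_partition :: "('a, 'b) monoid_scheme \<Rightarrow> ('a \<Rightarrow> 'a) set \<Rightarrow> 'a set set" where
  "upper_partition G K = system_of_block K (section_top G K)"

definition generalized_wreath_product ::
  "'a set \<Rightarrow> ('a \<Rightarrow> 'a) set \<Rightarrow> 'a set set \<Rightarrow> 'a set set \<Rightarrow> bool" where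
  "generalized_wreath_product S K \<LL> \<UU> \<longleftrightarrow>
     subgroup K (BijGroup S) \<and>
     transitive_action (perm_group S K) S (\<lambda>f. f) \<and>
     imprimitivity_system S K \<LL> \<and> imprimitivity_system S K \<UU> \<and>
     (\<forall>X\<in>\<LL>. \<exists>Y\<in>\<UU>. X \<subseteq> Y) \<and>
     blockwise_stabilizer K \<LL> = blockwise_product S (blockwise_stabilizer K \<LL>) \<UU>"

end

theory Submission
  imports Defs
begin

text \<open>Write \<open>L\<close> for the minimal block and \<open>H\<close> for the kernel of \<open>K\<close> on the blocks of \<open>\<LL>\<close>.
  The socle has trivial centralizer, so every nontrivial subgroup normalized by the socle contains
  it. Blocks through \<open>\<one>\<close> of a group containing \<open>L\<^sup>*\<close> are such subgroups if they lie in \<open>L\<close>; hence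
  the nontrivial \<open>H\<close>-blocks through \<open>\<one>\<close> inside \<open>L\<close> have a nontrivial intersection. As \<open>H\<close> is normal
  in \<open>K\<close>, this intersection is a \<open>K\<close>-block and so equals \<open>L\<close>: the group \<open>H\<close> is primitive on each
  block of \<open>\<LL>\<close>, and a normal subgroup of \<open>H\<close> is trivial or transitive on each of them. If
  \<open>X \<sim> X'\<close> fails, then the kernel of \<open>H\<close> on one of the two blocks acts nontrivially, hence
  transitively, on the other, so \<open>X \<times> X'\<close> is a single \<open>H\<close>-orbit. A permutation that agrees on each
  block of \<open>\<UU>\<close> with an element of \<open>H\<close> therefore preserves all \<open>K\<close>-orbits on pairs, and 2-closedness
  puts it into \<open>K\<close>.\<close>

section \<open>The socle of an almost simple group\<close>

context group
begin

text \<open>A nontrivial normal subgroup inside \<open>N\<close> of least cardinality is minimal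
  normal: a competitor contained in it has at least as many elements, so by finiteness it is equal
  to it.\<close>

lemma minimal_normal_subset_exists:
  assumes "finite (carrier G)" and "N \<lhd> G" and "N \<noteq> {\<one>}"
  obtains M where "minimal_normal G M" and "M \<subseteq> N"
proof -
  define P where "P M \<longleftrightarrow> M \<lhd> G \<and> M \<subseteq> N \<and> M \<noteq> {\<one>}" for M
  have "P N"
    using assms by (simp add: P_def)
  then obtain M where M: "P M" and least: "\<And>M'. P M' \<Longrightarrow> card M \<le> card M'"
    by (metis arg_min_natI arg_min_nat_le)
  have "finite M"
    using M assms(1) unfolding P_def
    by (meson finite_subset normal_imp_subgroup subgroup.subset)
  have "M' = M" if "M' \<lhd> G" "M' \<subseteq> M" "M' \<noteq> {\<one>}" for M'
  proof -
    have "P M'"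
      using that M by (auto simp: P_def)
    then show ?thesis
      using card_seteq[OF \<open>finite M\<close> that(2)] least by blast
  qed
  then have "minimal_normal G M"
    using M by (auto simp: minimal_normal_def P_def)
  then show thesis
    using M that by (auto simp: P_def)
qed

lemma normal_carrier_subset: "N \<lhd> G \<Longrightarrow> N \<subseteq> carrier G"
  by (simp add: normal_imp_subgroup subgroup.subset)

lemma socle_normal: "socle G \<lhd> G"
  unfolding socle_def
proof (rule normal_generateI)
  show "\<Union> {N. minimal_normal G N} \<subseteq> carrier G"
    using normal_carrier_subset by (auto simp: minimal_normal_def)
  show "g \<otimes> h \<otimes> inv g \<in> \<Union> {N. minimal_normal G N}"
    if "h \<in> \<Union> {N. minimal_normal G N}" "g \<in> carrier G" for h g
    using that normal.inv_op_closed2 by (fastforce simp: minimal_normal_def)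
qed

lemma minimal_normal_subset_socle: "minimal_normal G M \<Longrightarrow> M \<subseteq> socle G"
  unfolding socle_def by (auto intro: generate.incl)

lemma centralizer_normal:
  assumes "N \<lhd> G"
  shows "{g \<in> carrier G. \<forall>s\<in>N. g \<otimes> s = s \<otimes> g} \<lhd> G" (is "?C \<lhd> G")
proof (rule normal_invI)
  have N: "s \<in> carrier G" if "s \<in> N" for s
    using that normal_carrier_subset[OF assms] by blast
  show "subgroup ?C G"
  proof
    fix x y assume x: "x \<in> ?C" and y: "y \<in> ?C"
    have "x \<otimes> y \<otimes> s = s \<otimes> (x \<otimes> y)" if s: "s \<in> N" for s
    proof -
      have "x \<otimes> y \<otimes> s = x \<otimes> (s \<otimes> y)"
        using x y s N by (simp add: m_assoc)
      also have "\<dots> = s \<otimes> x \<otimes> y"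
        using x y s N by (simp flip: m_assoc)
      finally show ?thesis
        using x y s N by (simp add: m_assoc)
    qed
    then show "x \<otimes> y \<in> ?C"
      using x y by simp
  next
    fix x assume x: "x \<in> ?C"
    have "inv x \<otimes> s = s \<otimes> inv x" if s: "s \<in> N" for s
    proof -
      have x': "x \<in> carrier G"
        using x by simp
      then have "inv x \<otimes> s = inv x \<otimes> (s \<otimes> x) \<otimes> inv x"
        using s N by (simp add: m_assoc)
      also have "s \<otimes> x = x \<otimes> s"
        using x s by simp
      also have "inv x \<otimes> (x \<otimes> s) \<otimes> inv x = s \<otimes> inv x"
        using x' s N by (simp flip: m_assoc)
      finally show ?thesis .
    qed
    then show "inv x \<in> ?C"
      using x by simp
  qed (use N in auto)
  fix g x assume g: "g \<in> carrier G" and x: "x \<in> ?C"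
  have "g \<otimes> x \<otimes> inv g \<otimes> s = s \<otimes> (g \<otimes> x \<otimes> inv g)" if s: "s \<in> N" for s
  proof -
    \<comment> \<open>Conjugation by \<open>g\<close> turns the claim about \<open>g x g^-1\<close>
      and \<open>s\<close> into one about \<open>x\<close> and \<open>t\<close>; normality keeps
      \<open>t\<close> in \<open>N\<close>.\<close>
    define t where "t = inv g \<otimes> s \<otimes> g"
    have t: "t \<in> N"
      using assms g s by (simp add: t_def normal.inv_op_closed1)
    have s_eq: "s = g \<otimes> t \<otimes> inv g"
      using g s N by (simp add: t_def flip: m_assoc) (simp add: m_assoc)
    have x': "x \<in> carrier G"
      using x by simp
    have cancel: "inv g \<otimes> (g \<otimes> y) = y" if "y \<in> carrier G" for y
      using g that by (simp flip: m_assoc)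
    have "g \<otimes> x \<otimes> inv g \<otimes> s = g \<otimes> (x \<otimes> t) \<otimes> inv g"
      unfolding s_eq using g x' t N by (simp add: cancel m_assoc)
    also have "x \<otimes> t = t \<otimes> x"
      using x t by simp
    also have "g \<otimes> (t \<otimes> x) \<otimes> inv g = s \<otimes> (g \<otimes> x \<otimes> inv g)"
      unfolding s_eq using g x' t N by (simp add: cancel m_assoc)
    finally show ?thesis .
  qed
  then show "g \<otimes> x \<otimes> inv g \<in> ?C"
    using g x by simp
qed

text \<open>The centralizer of the socle is normal, so if it is nontrivial it contains a minimal
  normal subgroup \<open>M\<close>. As \<open>M\<close> also lies in the socle, simplicity makes it
  the whole socle, which would then commute with itself.\<close>

lemma almost_simple_centralizer_socle:
  assumes fin: "finite (carrier G)" and as: "almost_simple G"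
    and g: "g \<in> carrier G" "\<And>s. s \<in> socle G \<Longrightarrow> g \<otimes> s = s \<otimes> g"
  shows "g = \<one>"
proof (rule ccontr)
  assume "g \<noteq> \<one>"
  let ?S = "socle G"
  let ?C = "{g \<in> carrier G. \<forall>s\<in>?S. g \<otimes> s = s \<otimes> g}"
  have "?C \<noteq> {\<one>}"
    using g \<open>g \<noteq> \<one>\<close> by blast
  then obtain M where M: "minimal_normal G M" "M \<subseteq> ?C"
    using minimal_normal_subset_exists[OF fin centralizer_normal[OF socle_normal]] by blast
  have S: "subgroup ?S G"
    by (simp add: normal_imp_subgroup socle_normal)
  have "M \<lhd> G\<lparr>carrier := ?S\<rparr>"
    using normal_restrict_supergroup[OF S _ minimal_normal_subset_socle[OF M(1)]] M(1)
    by (simp add: minimal_normal_def)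
  then have "M = ?S"
    using simple_group.no_real_normal_subgroup[of "G\<lparr>carrier := ?S\<rparr>" M] as M(1)
    by (auto simp: almost_simple_def minimal_normal_def)
  then have "comm_group (G\<lparr>carrier := ?S\<rparr>)"
    using M(2) by (intro group.group_comm_groupI subgroup_imp_group[OF S]) auto
  then show False
    using as by (simp add: almost_simple_def)
qed

text \<open>The commutators of \<open>B\<close> and the socle lie in \<open>B \<inter> socle G\<close>, which by simplicity is trivial or
  the socle; in the former case \<open>B\<close> centralizes the socle.\<close>

lemma almost_simple_socle_subset:
  assumes fin: "finite (carrier G)" and as: "almost_simple G"
    and B: "subgroup B G" "B \<noteq> {\<one>}"
    and conj: "\<And>s b. s \<in> socle G \<Longrightarrow> b \<in> B \<Longrightarrow> s \<otimes> b \<otimes> inv s \<in> B"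
  shows "socle G \<subseteq> B"
proof -
  let ?S = "socle G"
  have S: "subgroup ?S G"
    by (simp add: normal_imp_subgroup socle_normal)
  note mem = subgroup.mem_carrier[OF S] subgroup.mem_carrier[OF B(1)]
  have "B \<inter> ?S \<lhd> G\<lparr>carrier := ?S\<rparr>"
  proof (rule group.normal_invI[OF subgroup_imp_group[OF S]])
    show "subgroup (B \<inter> ?S) (G\<lparr>carrier := ?S\<rparr>)"
      by (simp add: B(1) S subgroup_incl subgroups_Inter_pair)
    fix s b assume "s \<in> carrier (G\<lparr>carrier := ?S\<rparr>)" "b \<in> B \<inter> ?S"
    then show "s \<otimes>\<^bsub>G\<lparr>carrier := ?S\<rparr>\<^esub> b \<otimes>\<^bsub>G\<lparr>carrier := ?S\<rparr>\<^esub> inv\<^bsub>G\<lparr>carrier := ?S\<rparr>\<^esub> s \<in> B \<inter> ?S"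
      using conj S by (simp add: m_inv_consistent subgroup.m_closed subgroup.m_inv_closed)
  qed
  then have "B \<inter> ?S = ?S \<or> B \<inter> ?S = {\<one>}"
    using simple_group.no_real_normal_subgroup[of "G\<lparr>carrier := ?S\<rparr>"] as
    by (auto simp: almost_simple_def)
  moreover have False if triv: "B \<inter> ?S = {\<one>}"
  proof -
    have "b \<otimes> s = s \<otimes> b" if b: "b \<in> B" and s: "s \<in> ?S" for b s
    proof -
      let ?c = "s \<otimes> b \<otimes> inv s \<otimes> inv b"
      have "?c \<in> B"
        using b s conj B(1) by (simp add: subgroup.m_closed subgroup.m_inv_closed)
      moreover have "b \<otimes> inv s \<otimes> inv b \<in> ?S"
        using b s mem S socle_normal normal.inv_op_closed2 subgroup.m_inv_closed by metis
      then have "?c \<in> ?S"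
        using b s mem S by (simp add: m_assoc subgroup.m_closed)
      ultimately have "?c = \<one>"
        using triv by blast
      then have "s \<otimes> b \<otimes> inv s = b"
        using b s mem by (metis inv_closed inv_equality inv_inv m_closed)
      then show ?thesis
        using b s mem by (metis inv_solve_right' m_closed)
    qed
    then have "b = \<one>" if "b \<in> B" for b
      using almost_simple_centralizer_socle[OF fin as] that mem by blast
    then show False
      using B subgroup.one_closed by blast
  qed
  ultimately show ?thesis
    by blast
qed

text \<open>A map in \<open>H\<close> that sends one point of \<open>B\<close> into \<open>B\<close>
  preserves \<open>B\<close>. Left multiplication by \<open>x\<close> in \<open>B\<close> sends
  \<open>\<one>\<close> to \<open>x\<close>, and left multiplication by \<open>x^-1\<close> sends
  \<open>x\<close> to \<open>\<one>\<close>, so \<open>B\<close> is a subgroup. Conjugation by a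
  socle element fixes \<open>\<one>\<close>, so the socle normalizes \<open>B\<close>. The sets
  \<open>H\<close> and \<open>L\<close> are kept general in order to cover both \<open>K\<close>
  with the whole group and the kernel with the minimal block.\<close>

lemma almost_simple_socle_subset_block:
  assumes fin: "finite (carrier G)" and as: "almost_simple G"
    and L: "subgroup L G" "socle G \<subseteq> L"
    and H: "\<And>a b. a \<in> L \<Longrightarrow> b \<in> L \<Longrightarrow> (\<lambda>x\<in>carrier G. a \<otimes> x \<otimes> b) \<in> H"
    and B: "imprimitivity_block (carrier G) H B" "B \<subseteq> L" "\<one> \<in> B" "B \<noteq> {\<one>}"
  shows "socle G \<subseteq> B"
proof (rule almost_simple_socle_subset[OF fin as])
  note mem = subgroup.mem_carrier[OF L(1)]
  have BG: "x \<in> carrier G" "x \<in> L" if "x \<in> B" for x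
    using that B(2) mem by auto
  have fix_B: "a \<otimes> y \<otimes> b \<in> B"
    if "a \<in> L" "b \<in> L" "x \<in> B" "a \<otimes> x \<otimes> b \<in> B" "y \<in> B" for a b x y
  proof -
    let ?f = "\<lambda>x\<in>carrier G. a \<otimes> x \<otimes> b"
    have "?f x = a \<otimes> x \<otimes> b"
      using that BG(1) by simp
    then have "?f ` B \<inter> B \<noteq> {}"
      using that(3,4) by (metis IntI empty_iff imageI)
    then have "?f ` B = B"
      using H[OF that(1,2)] B(1) unfolding imprimitivity_block_def by blast
    then have "?f y \<in> B"
      using that(5) by blast
    then show ?thesis
      using that BG by simp
  qed
  have one: "\<one> \<in> L" and inv_L: "\<And>x. x \<in> L \<Longrightarrow> inv x \<in> L"
    using L(1) by (auto simp: subgroup.one_closed subgroup.m_inv_closed)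
  show "subgroup B G"
  proof
    fix x y assume xy: "x \<in> B" "y \<in> B"
    show "x \<otimes> y \<in> B"
      using fix_B[of x \<one> \<one> y] xy BG one B(3) by simp
  next
    fix x assume x: "x \<in> B"
    show "inv x \<in> B"
      using fix_B[of "inv x" \<one> x \<one>] x BG one inv_L B(3) by simp
  qed (use BG B(3) in auto)
  show "s \<otimes> b \<otimes> inv s \<in> B" if "s \<in> socle G" "b \<in> B" for s b
    using fix_B[of s "inv s" \<one> b] that L(2) inv_L mem B(3) by auto
qed (fact B(4))

end

section \<open>Blocks of permutation groups\<close>

lemma image_image_inverse: "(\<And>x. x \<in> B \<Longrightarrow> f (g x) = x) \<Longrightarrow> f ` g ` B = B"
  by (force simp: image_iff)

text \<open>If the image of the intersection meets the intersection, then \<open>f\<close> maps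
  every member of the family onto itself, and injectivity lets the image commute with the
  intersection. The common point \<open>x\<close> keeps the intersection nonempty.\<close>

lemma imprimitivity_block_Inter:
  assumes inj: "\<And>f. f \<in> K \<Longrightarrow> inj_on f S"
    and B: "\<And>B. B \<in> \<B> \<Longrightarrow> imprimitivity_block S K B \<and> x \<in> B" and "\<B> \<noteq> {}"
  shows "imprimitivity_block S K (\<Inter>\<B>)"
  unfolding imprimitivity_block_def
proof (intro conjI ballI)
  show "\<Inter>\<B> \<subseteq> S" "\<Inter>\<B> \<noteq> {}"
    using B assms(3) unfolding imprimitivity_block_def by blast+
  fix f assume f: "f \<in> K"
  have "f ` \<Inter>\<B> = \<Inter>\<B>" if "f ` \<Inter>\<B> \<inter> \<Inter>\<B> \<noteq> {}"
  proof -
    have "f ` B = B" if "B \<in> \<B>" for B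
      using B[OF that] f \<open>f ` \<Inter>\<B> \<inter> \<Inter>\<B> \<noteq> {}\<close> that
      unfolding imprimitivity_block_def by blast
    moreover have "f ` \<Inter>\<B> = (\<Inter>B\<in>\<B>. f ` B)"
      using image_INT[OF inj[OF f], of \<B> "\<lambda>B. B"] B assms(3)
      by (auto simp: imprimitivity_block_def)
    ultimately show ?thesis
      by auto
  qed
  then show "f ` \<Inter>\<B> = \<Inter>\<B> \<or> f ` \<Inter>\<B> \<inter> \<Inter>\<B> = {}"
    by blast
qed

section \<open>Permutation groups in terms of the values of their elements\<close>

locale permutation_group =
  fixes S :: "'a set" and K :: "('a \<Rightarrow> 'a) set"
  assumes subgroup_BijGroup: "subgroup K (BijGroup S)"
begin

lemma mem_Bij: "f \<in> K \<Longrightarrow> f \<in> Bij S"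
  using subgroup.subset[OF subgroup_BijGroup] by (auto simp: BijGroup_def)

lemma mem_bij_betw: "f \<in> K \<Longrightarrow> bij_betw f S S"
  using mem_Bij by (simp add: Bij_def)

lemma mem_inj_on: "f \<in> K \<Longrightarrow> inj_on f S"
  using mem_bij_betw by (simp add: bij_betw_def)

lemma mem_closed: "f \<in> K \<Longrightarrow> x \<in> S \<Longrightarrow> f x \<in> S"
  using mem_bij_betw bij_betwE by blast

lemma mem_eq_iff: "f \<in> K \<Longrightarrow> x \<in> S \<Longrightarrow> y \<in> S \<Longrightarrow> f x = f y \<longleftrightarrow> x = y"
  by (meson inj_on_eq_iff mem_inj_on)

lemma compose_mem: "f \<in> K \<Longrightarrow> g \<in> K \<Longrightarrow> compose S f g \<in> K"
  using subgroup.m_closed[OF subgroup_BijGroup, of f g] mem_Bij by (simp add: BijGroup_def)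

lemma id_mem: "(\<lambda>x\<in>S. x) \<in> K"
  using subgroup.one_closed[OF subgroup_BijGroup] by (simp add: BijGroup_def)

lemma inverse_mem:
  assumes "f \<in> K"
  obtains g where "g \<in> K" "\<And>x. x \<in> S \<Longrightarrow> g (f x) = x" "\<And>x. x \<in> S \<Longrightarrow> f (g x) = x"
proof
  have "m_inv (BijGroup S) f = restrict (inv_into S f) S"
    using mem_Bij[OF assms] by (simp add: inv_BijGroup)
  then show "restrict (inv_into S f) S \<in> K"
    using subgroup.m_inv_closed[OF subgroup_BijGroup assms] by simp
  have "f ` S = S"
    using mem_bij_betw[OF assms] by (simp add: bij_betw_def)
  then show "restrict (inv_into S f) S (f x) = x" "f (restrict (inv_into S f) S x) = x" if "x \<in> S" for x
    using that mem_inj_on[OF assms] mem_closed[OF assms] by (simp_all add: f_inv_into_f)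
qed

lemma group_perm_group: "group (perm_group S K)"
  by (rule subgroup.subgroup_is_group[OF subgroup_BijGroup group_BijGroup])

lemma transitive_actionI:
  assumes "\<And>x y. x \<in> S \<Longrightarrow> y \<in> S \<Longrightarrow> \<exists>f\<in>K. f x = y"
  shows "transitive_action (perm_group S K) S (\<lambda>f. f)"
proof -
  have "(\<lambda>f. f) \<in> hom (perm_group S K) (BijGroup S)"
    using mem_Bij by (auto simp: hom_def BijGroup_def)
  then have "group_hom (perm_group S K) (BijGroup S) (\<lambda>f. f)"
    by (simp add: group_hom_def group_hom_axioms_def group_perm_group group_BijGroup)
  then show ?thesis
    using assms by (simp add: transitive_action_def group_action_def transitive_action_axioms_def)
qed

lemma point_orbits_eq: "point_orbits S K = {{f x | f. f \<in> K} | x. x \<in> S}"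
  by (simp add: point_orbits_def orbits_def orbit_def)

lemma pair_orbits_eq:
  "pair_orbits S K = {{(f x, f y) | f. f \<in> K} | x y. x \<in> S \<and> y \<in> S}"
  by (auto simp: pair_orbits_def orbits_def orbit_def)

text \<open>Agreement with some element of \<open>K\<close> on every pair of points makes
  \<open>f\<close> map each orbit on pairs into itself. Orbits are finite and \<open>f\<close> is
  injective, so the inclusion is an equality, as 2-closedness requires.\<close>

lemma two_closed_mem:
  assumes "finite S" and tc: "two_closed S K" and f: "f \<in> Bij S"
    and loc: "\<And>x y. x \<in> S \<Longrightarrow> y \<in> S \<Longrightarrow> \<exists>k\<in>K. f x = k x \<and> f y = k y"
  shows "f \<in> K"
proof -
  have "map_prod f f ` R = R" if R: "R \<in> pair_orbits S K" for R
  proof (rule endo_inj_surj)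
    obtain x y where xy: "x \<in> S" "y \<in> S" and R_eq: "R = {(k x, k y) | k. k \<in> K}"
      using R pair_orbits_eq by auto
    have sub: "R \<subseteq> S \<times> S"
      using xy mem_closed by (auto simp: R_eq)
    then show "finite R"
      using assms(1) finite_subset by blast
    show "map_prod f f ` R \<subseteq> R"
    proof
      fix p assume "p \<in> map_prod f f ` R"
      then obtain k where k: "k \<in> K" "p = (f (k x), f (k y))"
        by (auto simp: R_eq)
      obtain l where l: "l \<in> K" "f (k x) = l (k x)" "f (k y) = l (k y)"
        using loc k(1) xy mem_closed by metis
      have "compose S l k \<in> K" "p = (compose S l k x, compose S l k y)"
        using compose_mem k l xy by (simp_all add: compose_eq)
      then show "p \<in> R"
        unfolding R_eq by blast
    qed
    have "inj_on f S"
      using f by (simp add: Bij_def bij_betw_def)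
    then show "inj_on (map_prod f f) R"
      using map_prod_inj_on inj_on_subset[OF _ sub] by blast
  qed
  then show ?thesis
    using tc f by (simp add: two_closed_def)
qed

section \<open>The kernel of the action on a system of blocks\<close>

lemma blockwise_stabilizer_permutation_group:
  assumes "\<And>X. X \<in> P \<Longrightarrow> X \<subseteq> S"
  shows "permutation_group S (blockwise_stabilizer K P)"
proof (intro permutation_group.intro group.subgroupI[OF group_BijGroup])
  let ?H = "blockwise_stabilizer K P"
  show "?H \<subseteq> carrier (BijGroup S)"
    using mem_Bij by (auto simp: blockwise_stabilizer_def BijGroup_def)
  have "(\<lambda>x\<in>S. x) ` X = X" if "X \<in> P" for X
    using assms[OF that] by (auto simp: image_iff subset_iff)
  then show "?H \<noteq> {}"
    using id_mem unfolding blockwise_stabilizer_def by blast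
  fix f assume f: "f \<in> ?H"
  then have fK: "f \<in> K"
    by (simp add: blockwise_stabilizer_def)
  have inv_f: "m_inv (BijGroup S) f = restrict (inv_into S f) S"
    using mem_Bij[OF fK] by (simp add: inv_BijGroup)
  have "restrict (inv_into S f) S ` X = X" if "X \<in> P" for X
  proof -
    have "inv_into S f ` f ` X = X"
      using inv_into_image_cancel mem_inj_on[OF fK] assms[OF that] by blast
    moreover have "f ` X = X"
      using f that by (simp add: blockwise_stabilizer_def)
    moreover have "restrict (inv_into S f) S ` X = inv_into S f ` X"
      using assms[OF that] by (intro image_cong) auto
    ultimately show ?thesis
      by metis
  qed
  then show "m_inv (BijGroup S) f \<in> ?H"
    using subgroup.m_inv_closed[OF subgroup_BijGroup fK] inv_f
    by (simp add: blockwise_stabilizer_def)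
  fix g assume g: "g \<in> ?H"
  then have gK: "g \<in> K"
    by (simp add: blockwise_stabilizer_def)
  have "compose S f g ` X = X" if "X \<in> P" for X
  proof -
    have "compose S f g ` X = f ` g ` X"
      using assms[OF that] by (force simp: compose_def image_iff)
    then show ?thesis
      using f g that by (simp add: blockwise_stabilizer_def)
  qed
  then show "f \<otimes>\<^bsub>BijGroup S\<^esub> g \<in> ?H"
    using compose_mem[OF fK gK] mem_Bij[OF fK] mem_Bij[OF gK]
    by (simp add: blockwise_stabilizer_def BijGroup_def)
qed

text \<open>This is normality of the kernel, written on points. The witness is
  \<open>k h k^-1\<close>, which fixes a block \<open>X\<close> because \<open>h\<close> fixes the
  block \<open>k^-1 X\<close>.\<close>

lemma blockwise_stabilizer_conjugate:
  assumes sys: "imprimitivity_system S K P"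
    and k: "k \<in> K" and h: "h \<in> blockwise_stabilizer K P"
  shows "\<exists>h'\<in>blockwise_stabilizer K P. \<forall>x\<in>S. k (h x) = h' (k x)"
proof -
  obtain k' where k': "k' \<in> K" "\<And>x. x \<in> S \<Longrightarrow> k' (k x) = x" "\<And>x. x \<in> S \<Longrightarrow> k (k' x) = x"
    using inverse_mem[OF k] by blast
  have hK: "h \<in> K"
    using h by (simp add: blockwise_stabilizer_def)
  let ?h = "compose S k (compose S h k')"
  have "?h ` X = X" if X: "X \<in> P" for X
  proof -
    have XS: "X \<subseteq> S"
      using sys X by (auto simp: imprimitivity_system_def partition_on_def)
    have "?h ` X = k ` h ` k' ` X"
      using XS by (force simp: compose_def image_iff)
    also have "h ` k' ` X = k' ` X"
      using sys h k'(1) X by (simp add: blockwise_stabilizer_def imprimitivity_system_def)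
    also have "k ` k' ` X = X"
      using k'(3) XS by (intro image_image_inverse) auto
    finally show ?thesis .
  qed
  moreover have "?h \<in> K"
    using compose_mem k k'(1) hK by simp
  moreover have "k (h x) = ?h (k x)" if "x \<in> S" for x
    using that k' mem_closed[OF k] by (simp add: compose_def)
  ultimately show ?thesis
    unfolding blockwise_stabilizer_def by blast
qed

text \<open>Since \<open>K\<close> preserves \<open>X\<close>, the elements fixing \<open>X\<close>
  pointwise form a normal subgroup, and an orbit of a normal subgroup is a block.\<close>

lemma pointwise_stabilizer_orbit_block:
  assumes "finite S" and X: "X \<subseteq> S" "\<And>f. f \<in> K \<Longrightarrow> f ` X = X" and z: "z \<in> S"
  shows "imprimitivity_block S K {n z | n. n \<in> K \<and> (\<forall>x\<in>X. n x = x)}" (is "imprimitivity_block S K ?B")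
  unfolding imprimitivity_block_def
proof (intro conjI ballI)
  show BS: "?B \<subseteq> S"
    using mem_closed z by auto
  have "\<forall>x\<in>X. (\<lambda>x\<in>S. x) x = x"
    using X(1) by auto
  then show "?B \<noteq> {}"
    using id_mem by blast
  fix f assume f: "f \<in> K"
  obtain f' where f': "f' \<in> K" "\<And>x. x \<in> S \<Longrightarrow> f' (f x) = x" "\<And>x. x \<in> S \<Longrightarrow> f (f' x) = x"
    using inverse_mem[OF f] by blast
  have "f ` ?B = ?B" if meet: "f ` ?B \<inter> ?B \<noteq> {}"
  proof (rule endo_inj_surj)
    obtain m n where m: "m \<in> K" "\<And>x. x \<in> X \<Longrightarrow> m x = x" and n: "n \<in> K" "\<And>x. x \<in> X \<Longrightarrow> n x = x"
      and eq: "f (m z) = n z"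
      using meet by auto
    obtain m' where m': "m' \<in> K" "\<And>x. x \<in> S \<Longrightarrow> m' (m x) = x"
      using inverse_mem[OF m(1)] by blast
    show "finite ?B"
      using BS assms(1) by (rule finite_subset)
    show "inj_on f ?B"
      using mem_inj_on[OF f] BS by (rule inj_on_subset)
    show "f ` ?B \<subseteq> ?B"
    proof
      fix w assume "w \<in> f ` ?B"
      then obtain l where l: "l \<in> K" "\<And>x. x \<in> X \<Longrightarrow> l x = x" and w: "w = f (l z)"
        by auto
      \<comment> \<open>This is \<open>f l m^-1 f^-1 n\<close>. It sends \<open>z\<close> to
        \<open>f (l z)\<close> because \<open>f^-1 (n z) = m z\<close>, and it fixes
        \<open>X\<close> pointwise because \<open>f^-1\<close> keeps points of \<open>X\<close> in
        \<open>X\<close>, where \<open>m\<close> and \<open>l\<close> act trivially.\<close>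
      let ?g = "compose S f (compose S l (compose S m' (compose S f' n)))"
      have "f' (n z) = m z"
        using eq f'(2) mem_closed[OF m(1) z] by metis
      then have "w = ?g z"
        using z w m' by (simp add: compose_def)
      moreover have "?g x = x" if x: "x \<in> X" for x
      proof -
        have "f' x \<in> X"
          using X(2)[OF f'(1)] x by blast
        moreover from this have "m' (f' x) = f' x"
          using m(2) m'(2) X(1) by (metis subsetD)
        ultimately show ?thesis
          using x X(1) n(2) l(2) f'(3) by (simp add: compose_def subset_iff)
      qed
      moreover have "?g \<in> K"
        using compose_mem f l m' f' n by simp
      ultimately show "w \<in> ?B"
        by blast
    qed
  qed
  then show "f ` ?B = ?B \<or> f ` ?B \<inter> ?B = {}"
    by blast
qed

text \<open>Restriction from \<open>Z\<close> to \<open>X\<close> is always a surjective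
  homomorphism of the induced groups, so only injectivity is at stake, that is, triviality of the
  kernel. Two elements with equal restrictions are compared through \<open>g^-1 f\<close>.\<close>

lemma induced_restriction_iso_iff:
  assumes XZ: "X \<subseteq> Z" "Z \<subseteq> S"
    and inv: "\<And>f. f \<in> K \<Longrightarrow> f ` X = X" "\<And>f. f \<in> K \<Longrightarrow> f ` Z = Z"
  shows "(\<lambda>f. restrict f X) \<in> iso (perm_group Z (induced K Z)) (perm_group X (induced K X)) \<longleftrightarrow>
    (\<forall>f\<in>K. (\<forall>x\<in>X. f x = x) \<longrightarrow> (\<forall>x\<in>Z. f x = x))" (is "?iso \<longleftrightarrow> ?ker")
proof
  have restr: "restrict (restrict f Z) X = restrict f X" for f :: "'a \<Rightarrow> 'a"
    using XZ(1) by (simp add: Int_absorb1)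
  {
    assume ?iso
    then have inj: "inj_on (\<lambda>f. restrict f X) (induced K Z)"
      by (simp add: iso_def bij_betw_def)
    show ?ker
    proof (intro ballI impI)
      fix f x assume f: "f \<in> K" "\<forall>x\<in>X. f x = x" and x: "x \<in> Z"
      have mem: "restrict f Z \<in> induced K Z" "restrict (\<lambda>x\<in>S. x) Z \<in> induced K Z"
        unfolding induced_def using f(1) id_mem by blast+
      have "restrict (restrict f Z) X = restrict (restrict (\<lambda>x\<in>S. x) Z) X"
        unfolding restr using f(2) XZ by (auto simp: restrict_def fun_eq_iff)
      then have "restrict f Z = restrict (\<lambda>x\<in>S. x) Z"
        using inj_onD[OF inj _ mem] by blast
      then have "restrict f Z x = restrict (\<lambda>x\<in>S. x) Z x"
        by (rule fun_cong)
      then show "f x = x"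
        using x XZ(2) by auto
    qed
  }
  assume ker: ?ker
  have Bij: "restrict f Y \<in> Bij Y" if "f \<in> K" "Y \<subseteq> S" "f ` Y = Y" for f Y
    using that inj_on_subset[OF mem_inj_on[OF that(1)] that(2)] by (simp add: Bij_def bij_betw_def)
  have "(\<lambda>f. restrict f X) \<in> hom (perm_group Z (induced K Z)) (perm_group X (induced K X))"
  proof (rule homI)
    fix f assume "f \<in> carrier (perm_group Z (induced K Z))"
    then obtain f0 where f0: "f0 \<in> K" "f = restrict f0 Z"
      by (auto simp: induced_def)
    then have fX: "restrict f X = restrict f0 X"
      by (simp only: restr)
    then show "restrict f X \<in> carrier (perm_group X (induced K X))"
      using f0(1) by (auto simp: induced_def)
    fix g assume "g \<in> carrier (perm_group Z (induced K Z))"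
    then obtain g0 where g0: "g0 \<in> K" "g = restrict g0 Z"
      by (auto simp: induced_def)
    then have gX: "restrict g X = restrict g0 X"
      by (simp only: restr)
    have XS: "X \<subseteq> S"
      using XZ by blast
    have fg: "f \<in> Bij Z" "g \<in> Bij Z" "restrict f X \<in> Bij X" "restrict g X \<in> Bij X"
      unfolding fX gX using Bij[OF f0(1) XZ(2)] Bij[OF g0(1) XZ(2)] Bij[OF f0(1) XS] Bij[OF g0(1) XS]
        inv f0 g0 by simp_all
    have "g x \<in> X" if "x \<in> X" for x
      using that g0 XZ inv(1)[of g0] by auto
    then have "restrict (compose Z f g) X = compose X (restrict f X) (restrict g X)"
      using XZ(1) by (auto simp: fun_eq_iff restrict_def compose_def)
    then show "restrict (f \<otimes>\<^bsub>perm_group Z (induced K Z)\<^esub> g) X =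
        restrict f X \<otimes>\<^bsub>perm_group X (induced K X)\<^esub> restrict g X"
      using fg by (simp add: BijGroup_def)
  qed
  moreover have "inj_on (\<lambda>f. restrict f X) (induced K Z)"
  proof (rule inj_onI)
    fix f g assume "f \<in> induced K Z" "g \<in> induced K Z" and eq: "restrict f X = restrict g X"
    then obtain f0 g0 where f0: "f0 \<in> K" "f = restrict f0 Z" and g0: "g0 \<in> K" "g = restrict g0 Z"
      by (auto simp: induced_def)
    obtain g' where g': "g' \<in> K" "\<And>x. x \<in> S \<Longrightarrow> g' (g0 x) = x" "\<And>x. x \<in> S \<Longrightarrow> g0 (g' x) = x"
      using inverse_mem[OF g0(1)] by blast
    have "restrict f0 X = restrict g0 X"
      using eq f0(2) g0(2) by (simp only: restr)
    then have "f0 x = g0 x" if "x \<in> X" for x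
      using that by (metis restrict_apply')
    then have "compose S g' f0 x = x" if "x \<in> X" for x
      using that XZ g'(2) by (auto simp: compose_def)
    then have "compose S g' f0 x = x" if "x \<in> Z" for x
      using ker compose_mem[OF g'(1) f0(1)] that by blast
    then have "f0 x = g0 x" if "x \<in> Z" for x
      using that XZ(2) g'(3) mem_closed[OF f0(1)] by (metis compose_eq subsetD)
    then show "f = g"
      unfolding f0(2) g0(2) by (auto simp: restrict_def fun_eq_iff)
  qed
  moreover have "(\<lambda>f. restrict f X) ` induced K Z = induced K X"
    unfolding induced_def image_image by (simp only: restr)
  ultimately show ?iso
    by (simp add: iso_def bij_betw_def)
qed

text \<open>The kernel criterion is applied twice, to the two restrictions from the union. In this
  form linkage is visibly an equivalence relation.\<close>

lemma linked_blocks_iff: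
  assumes "X \<subseteq> S" "X' \<subseteq> S" and "\<And>f. f \<in> K \<Longrightarrow> f ` X = X" "\<And>f. f \<in> K \<Longrightarrow> f ` X' = X'"
  shows "linked_blocks K X X' \<longleftrightarrow> (\<forall>f\<in>K. (\<forall>x\<in>X. f x = x) \<longleftrightarrow> (\<forall>x\<in>X'. f x = x))"
proof -
  have U: "X \<union> X' \<subseteq> S" "\<And>f. f \<in> K \<Longrightarrow> f ` (X \<union> X') = X \<union> X'"
    using assms by (simp_all add: image_Un)
  note iso = induced_restriction_iso_iff[OF Un_upper1 U(1) assms(3) U(2)]
    induced_restriction_iso_iff[OF Un_upper2 U(1) assms(4) U(2)]
  show ?thesis
    by (simp add: linked_blocks_def iso) blast
qed

end

section \<open>Transitive groups and the translates of a block\<close>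

locale transitive_permutation_group = permutation_group +
  assumes transitive: "x \<in> S \<Longrightarrow> y \<in> S \<Longrightarrow> \<exists>f\<in>K. f x = y"
begin

text \<open>Translates cover \<open>S\<close> by transitivity. If \<open>f B\<close> and
  \<open>g B\<close> share a point, then \<open>g^-1 f\<close> sends a point of \<open>B\<close>
  into \<open>B\<close>, hence preserves \<open>B\<close>, and the translates coincide.\<close>

lemma system_of_block_imprimitivity:
  assumes B: "imprimitivity_block S K B"
  shows "imprimitivity_system S K (system_of_block K B)"
  unfolding imprimitivity_system_def partition_on_def
proof (intro conjI ballI disjointI)
  have BS: "B \<subseteq> S" and "B \<noteq> {}"
    using B by (auto simp: imprimitivity_block_def)
  then obtain b where b: "b \<in> B" "b \<in> S"
    by blast
  show "\<Union> (system_of_block K B) = S"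
  proof
    show "\<Union> (system_of_block K B) \<subseteq> S"
      using mem_closed BS by (auto simp: system_of_block_def)
    show "S \<subseteq> \<Union> (system_of_block K B)"
    proof
      fix x assume "x \<in> S"
      then obtain f where "f \<in> K" "f b = x"
        using transitive[OF b(2)] by blast
      then show "x \<in> \<Union> (system_of_block K B)"
        using b(1) by (auto simp: system_of_block_def)
    qed
  qed
  show "{} \<notin> system_of_block K B"
    using \<open>B \<noteq> {}\<close> by (auto simp: system_of_block_def)
  fix X Y assume "X \<in> system_of_block K B" "Y \<in> system_of_block K B" and "X \<noteq> Y"
  then obtain f g where fg: "f \<in> K" "g \<in> K" and X: "X = f ` B" and Y: "Y = g ` B"
    by (auto simp: system_of_block_def)
  show "X \<inter> Y = {}"
  proof (rule ccontr)
    assume "X \<inter> Y \<noteq> {}"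
    then obtain u v where uv: "u \<in> B" "v \<in> B" "f u = g v"
      unfolding X Y by auto
    obtain g' where g': "g' \<in> K" "\<And>x. x \<in> S \<Longrightarrow> g' (g x) = x" "\<And>x. x \<in> S \<Longrightarrow> g (g' x) = x"
      using inverse_mem[OF fg(2)] by blast
    have "compose S g' f u = v"
      using uv BS g' by (auto simp: compose_def)
    then have "compose S g' f ` B = B"
      using B compose_mem[OF g'(1) fg(1)] uv unfolding imprimitivity_block_def by blast
    moreover have "compose S g' f ` B = g' ` f ` B"
      using BS by (force simp: compose_def image_iff)
    moreover have "g ` g' ` f ` B = f ` B"
      using g'(3) mem_closed[OF fg(1)] BS by (intro image_image_inverse) auto
    ultimately show False
      using \<open>X \<noteq> Y\<close> X Y by simp
  qed
next
  fix f X assume f: "f \<in> K" and "X \<in> system_of_block K B"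
  then obtain g where g: "g \<in> K" and X: "X = g ` B"
    by (auto simp: system_of_block_def)
  have "f ` X = compose S f g ` B"
    using B by (force simp: compose_def image_iff X imprimitivity_block_def)
  then show "f ` X \<in> system_of_block K B"
    using compose_mem[OF f g] by (auto simp: system_of_block_def)
qed

lemma system_of_block_self:
  assumes "B \<subseteq> S"
  shows "B \<in> system_of_block K B"
proof -
  have "(\<lambda>x\<in>S. x) ` B = B"
    using assms by force
  then show ?thesis
    unfolding system_of_block_def using id_mem by (metis (mono_tags, lifting) CollectI)
qed

end

section \<open>Normal subgroups of a transitive group and their blocks\<close>

locale normal_permutation_subgroup =
  transitive_permutation_group S K + H: permutation_group S H
  for S :: "'a set" and K H +
  assumes finite_points: "finite S"
    and sub: "H \<subseteq> K"
    and conjugate: "\<lbrakk>k \<in> K; h \<in> H\<rbrakk> \<Longrightarrow> \<exists>h'\<in>H. \<forall>x\<in>S. k (h x) = h' (k x)"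
begin

text \<open>By normality \<open>h k = k h'\<close> for some \<open>h'\<close> in \<open>H\<close>,
  so the position of \<open>h (k B)\<close> relative to \<open>k B\<close> is that of
  \<open>h' B\<close> relative to \<open>B\<close>.\<close>

lemma imprimitivity_block_image:
  assumes "k \<in> K" and B: "imprimitivity_block S H B"
  shows "imprimitivity_block S H (k ` B)"
  unfolding imprimitivity_block_def
proof (intro conjI ballI)
  have BS: "B \<subseteq> S" and "B \<noteq> {}"
    using B by (auto simp: imprimitivity_block_def)
  show "k ` B \<subseteq> S" "k ` B \<noteq> {}"
    using BS \<open>B \<noteq> {}\<close> mem_closed[OF assms(1)] by auto
  fix h assume h: "h \<in> H"
  obtain k' where k': "k' \<in> K" "\<And>x. x \<in> S \<Longrightarrow> k' (k x) = x" "\<And>x. x \<in> S \<Longrightarrow> k (k' x) = x"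
    using inverse_mem[OF assms(1)] by blast
  obtain h' where h': "h' \<in> H" "\<And>x. x \<in> S \<Longrightarrow> k' (h x) = h' (k' x)"
    using conjugate[OF k'(1) h] by blast
  have "h (k x) = k (h' x)" if "x \<in> S" for x
    using h'(2)[of "k x"] that k' mem_closed[OF assms(1)] H.mem_closed[OF h] by metis
  then have eq: "h ` k ` B = k ` h' ` B"
    using BS by (force simp: image_iff)
  have "h' ` B = B \<or> h' ` B \<inter> B = {}"
    using B h'(1) by (auto simp: imprimitivity_block_def)
  then show "h ` k ` B = k ` B \<or> h ` k ` B \<inter> k ` B = {}"
  proof
    assume "h' ` B \<inter> B = {}"
    then have "k ` h' ` B \<inter> k ` B = {}"
      using BS H.mem_closed[OF h'(1)] inj_on_image_Int[OF mem_inj_on[OF assms(1)], of "h' ` B" B]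
      by auto
    then show ?thesis
      by (simp add: eq)
  qed (simp add: eq)
qed

text \<open>The intersections \<open>T x\<close> of all nontrivial \<open>H\<close>-blocks through \<open>x\<close> inside the translate of \<open>L\<close>
  through \<open>x\<close> are permuted by \<open>K\<close>, so \<open>T x\<^sub>0\<close> is a block of \<open>K\<close>.\<close>

lemma minimal_block_primitive:
  assumes L: "imprimitivity_block S K L" "x\<^sub>0 \<in> L"
    and minimal: "\<And>B. \<lbrakk>imprimitivity_block S K B; x\<^sub>0 \<in> B; B \<noteq> {x\<^sub>0}; B \<subseteq> L\<rbrakk> \<Longrightarrow> B = L"
    and c: "c \<noteq> x\<^sub>0"
      "\<And>B. \<lbrakk>imprimitivity_block S H B; x\<^sub>0 \<in> B; B \<noteq> {x\<^sub>0}; B \<subseteq> L\<rbrakk> \<Longrightarrow> c \<in> B"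
    and LH: "imprimitivity_block S H L" "L \<noteq> {x\<^sub>0}"
    and B: "imprimitivity_block S H B" "B \<subseteq> X" "X \<in> system_of_block K L" "x \<in> B" "y \<in> B" "x \<noteq> y"
  shows "B = X"
proof -
  define F where "F x = {B. imprimitivity_block S H B \<and> x \<in> B \<and> B \<noteq> {x} \<and>
    (\<exists>X\<in>system_of_block K L. B \<subseteq> X)}" for x
  define T where "T x = \<Inter>(F x)" for x
  have sys: "imprimitivity_system S K (system_of_block K L)"
    by (rule system_of_block_imprimitivity[OF L(1)])
  have blk: "X = Y" if "X \<in> system_of_block K L" "Y \<in> system_of_block K L" "z \<in> X" "z \<in> Y" for X Y z
    using sys that unfolding imprimitivity_system_def partition_on_def disjoint_def by blast
  have LS: "L \<subseteq> S"
    using L(1) by (simp add: imprimitivity_block_def)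
  have L_sys: "L \<in> system_of_block K L"
    by (rule system_of_block_self[OF LS])
  have F_x0: "B \<in> F x\<^sub>0 \<longleftrightarrow> imprimitivity_block S H B \<and> x\<^sub>0 \<in> B \<and> B \<noteq> {x\<^sub>0} \<and> B \<subseteq> L" for B
    using blk L_sys L(2) by (fastforce simp: F_def)
  have "L \<in> F x\<^sub>0"
    using F_x0 LH L(2) by blast
  have F_image: "k ` B \<in> F (k x)" if k: "k \<in> K" and B: "B \<in> F x" for k x B
  proof -
    have BS: "B \<subseteq> S" and x: "x \<in> B"
      using B by (auto simp: F_def imprimitivity_block_def)
    obtain y where "y \<in> B" "y \<noteq> x"
      using B by (auto simp: F_def)
    then have "k y \<noteq> k x" "k y \<in> k ` B"
      using mem_eq_iff[OF k] BS x by auto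
    moreover obtain X where "X \<in> system_of_block K L" "B \<subseteq> X"
      using B by (auto simp: F_def)
    then have "\<exists>X\<in>system_of_block K L. k ` B \<subseteq> X"
      using sys k unfolding imprimitivity_system_def by (meson image_mono)
    ultimately show ?thesis
      using B imprimitivity_block_image[OF k] x by (auto simp: F_def)
  qed
  have T_S: "T x \<subseteq> S" if x: "x \<in> S" for x
  proof -
    obtain k where k: "k \<in> K" "k x\<^sub>0 = x"
      using transitive[of x\<^sub>0 x] x L(2) LS by blast
    then have "k ` L \<in> F x"
      using F_image[OF k(1) \<open>L \<in> F x\<^sub>0\<close>] by simp
    then show ?thesis
      unfolding T_def using LS mem_closed[OF k(1)] by blast
  qed
  \<comment> \<open>One inclusion is proved directly; the reverse one comes from applying it to the
    inverse of \<open>k\<close>.\<close>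
  have T_sub: "T (k x) \<subseteq> k ` T x" if k: "k \<in> K" and x: "x \<in> S" for k x
  proof
    fix y assume y: "y \<in> T (k x)"
    obtain k' where k': "k' \<in> K" "\<And>x. x \<in> S \<Longrightarrow> k' (k x) = x" "\<And>x. x \<in> S \<Longrightarrow> k (k' x) = x"
      using inverse_mem[OF k] by blast
    have yS: "y \<in> S"
      using y T_S mem_closed[OF k x] by blast
    have "k' y \<in> B" if B: "B \<in> F x" for B
    proof -
      obtain z where "z \<in> B" "y = k z"
        using y F_image[OF k B] by (auto simp: T_def)
      moreover have "B \<subseteq> S"
        using B by (auto simp: F_def imprimitivity_block_def)
      ultimately show ?thesis
        using k'(2) by auto
    qed
    then have "k' y \<in> T x"
      by (simp add: T_def)
    then show "y \<in> k ` T x"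
      using k'(3)[OF yS] by force
  qed
  have T_image: "T (k x) = k ` T x" if k: "k \<in> K" and x: "x \<in> S" for k x
  proof
    obtain k' where k': "k' \<in> K" "\<And>x. x \<in> S \<Longrightarrow> k' (k x) = x" "\<And>x. x \<in> S \<Longrightarrow> k (k' x) = x"
      using inverse_mem[OF k] by blast
    have "T x \<subseteq> k' ` T (k x)"
      using T_sub[OF k'(1) mem_closed[OF k x]] k'(2)[OF x] by simp
    then have "k ` T x \<subseteq> k ` k' ` T (k x)"
      by (rule image_mono)
    moreover have "k ` k' ` T (k x) = T (k x)"
      using k'(3) T_S[OF mem_closed[OF k x]] by (intro image_image_inverse) auto
    ultimately show "k ` T x \<subseteq> T (k x)"
      by simp
  qed (rule T_sub[OF that])
  have x0: "x\<^sub>0 \<in> S"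
    using L(2) LS by blast
  have T_x0: "T x\<^sub>0 \<in> F x\<^sub>0"
    unfolding F_x0
  proof (intro conjI)
    show "imprimitivity_block S H (T x\<^sub>0)"
      unfolding T_def
      using \<open>L \<in> F x\<^sub>0\<close> H.mem_inj_on by (intro imprimitivity_block_Inter[of _ _ _ x\<^sub>0]) (auto simp: F_x0)
    show "x\<^sub>0 \<in> T x\<^sub>0"
      by (auto simp: T_def F_def)
    \<comment> \<open>The point \<open>c\<close>, common to all nontrivial \<open>H\<close>-blocks
      in \<open>L\<close> through \<open>x\<^sub>0\<close>, keeps the intersection from shrinking to
      a singleton.\<close>
    have "c \<in> T x\<^sub>0"
      using c(2) by (auto simp: T_def F_x0)
    then show "T x\<^sub>0 \<noteq> {x\<^sub>0}"
      using c(1) by blast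
    show "T x\<^sub>0 \<subseteq> L"
      using \<open>L \<in> F x\<^sub>0\<close> by (auto simp: T_def)
  qed
  have T_F: "T x \<in> F x" if "x \<in> S" for x
    using transitive[OF x0 that] F_image[OF _ T_x0] T_image[OF _ x0] by auto
  \<comment> \<open>The set \<open>T x\<close> is itself a nontrivial \<open>H\<close>-block through
    \<open>y\<close>, so it belongs to \<open>F y\<close> and contains \<open>T y\<close>. Equality
    follows by counting, since \<open>T x\<close> is a translate of \<open>T y\<close>.\<close>
  have T_eq: "T y = T x" if x: "x \<in> S" and y: "y \<in> T x" for x y
  proof (rule card_seteq)
    have yS: "y \<in> S"
      using T_S x y by blast
    have "x \<in> T x"
      by (auto simp: T_def F_def)
    then have "T x \<noteq> {y}"
      using T_F[OF x] y by (auto simp: F_def)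
    then have "T x \<in> F y"
      using T_F[OF x] y by (auto simp: F_def)
    then show "T y \<subseteq> T x"
      by (auto simp: T_def)
    obtain k where k: "k \<in> K" "k y = x"
      using transitive[OF yS x] by blast
    have "card (T x) = card (k ` T y)"
      using T_image[OF k(1) yS] k(2) by simp
    also have "\<dots> \<le> card (T y)"
      using T_S[OF yS] finite_points by (meson card_image_le finite_subset)
    finally show "card (T x) \<le> card (T y)" .
    show "finite (T x)"
      using T_S[OF x] finite_points by (rule finite_subset)
  qed
  have "imprimitivity_block S K (T x\<^sub>0)"
    unfolding imprimitivity_block_def
  proof (intro conjI ballI)
    show "T x\<^sub>0 \<subseteq> S" "T x\<^sub>0 \<noteq> {}"
      using T_x0 by (auto simp: F_def imprimitivity_block_def)
    fix k assume k: "k \<in> K"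
    have "k ` T x\<^sub>0 = T x\<^sub>0" if "z \<in> k ` T x\<^sub>0" "z \<in> T x\<^sub>0" for z
      using that T_eq[OF x0] T_eq[OF mem_closed[OF k x0]] T_image[OF k x0] by metis
    then show "k ` T x\<^sub>0 = T x\<^sub>0 \<or> k ` T x\<^sub>0 \<inter> T x\<^sub>0 = {}"
      by blast
  qed
  \<comment> \<open>Minimality of \<open>L\<close> identifies the block. Translation by
    \<open>k\<close> then gives \<open>T x = X\<close>, while \<open>B\<close>, being a member of
    \<open>F x\<close>, contains \<open>T x\<close>.\<close>
  then have T_L: "T x\<^sub>0 = L"
    using minimal T_x0 by (auto simp: F_x0)
  have xS: "x \<in> S"
    using B(1,4) by (auto simp: imprimitivity_block_def)
  have "B \<in> F x"
    using B by (auto simp: F_def)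
  then have "T x \<subseteq> B"
    by (auto simp: T_def)
  obtain k where k: "k \<in> K" "k x\<^sub>0 = x"
    using transitive[OF x0 xS] by blast
  have "k ` L \<in> system_of_block K L" "x \<in> k ` L" "x \<in> X"
    using k L(2) B(2,4) by (auto simp: system_of_block_def)
  then have "k ` L = X"
    using blk B(3) by blast
  moreover have "T x = k ` L"
    using T_image[OF k(1) x0] unfolding k(2) T_L .
  ultimately show "B = X"
    using \<open>T x \<subseteq> B\<close> B(2) by blast
qed

end

section \<open>The principal section\<close>

locale central_overgroup =
  group G + permutation_group "carrier G" K
  for G :: "('a, 'b) monoid_scheme" (structure) and K +
  assumes finite_carrier: "finite (carrier G)"
    and almost_simple: "almost_simple G"
    and translations_subset: "two_sided_translations G (carrier G) \<subseteq> K"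
begin

abbreviation L where "L \<equiv> minimal_block G K"
abbreviation \<LL> where "\<LL> \<equiv> lower_partition G K"
abbreviation H where "H \<equiv> blockwise_stabilizer K \<LL>"
abbreviation U where "U \<equiv> section_top G K"
abbreviation \<UU> where "\<UU> \<equiv> upper_partition G K"

lemma translation_mem:
  assumes a: "a \<in> carrier G" and b: "b \<in> carrier G"
  shows "(\<lambda>x\<in>carrier G. a \<otimes> x \<otimes> b) \<in> K"
proof -
  let ?l = "\<lambda>g\<in>carrier G. a \<otimes> g" and ?r = "\<lambda>g\<in>carrier G. g \<otimes> b"
  have inv_eq: "a \<otimes> (inv a \<otimes> x) = x" "inv a \<otimes> (a \<otimes> x) = x" if "x \<in> carrier G" for x
    using a that by (simp_all flip: m_assoc)
  have "bij_betw ?l (carrier G) (carrier G)"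
    using a inv_eq by (intro bij_betw_byWitness[where f' = "\<lambda>g. inv a \<otimes> g"]) auto
  moreover have "bij_betw ?r (carrier G) (carrier G)"
    using b by (intro bij_betw_byWitness[where f' = "\<lambda>g. g \<otimes> inv b"]) (auto simp: m_assoc)
  ultimately have "?l \<in> Bij (carrier G)" "?r \<in> Bij (carrier G)"
    by (simp_all add: Bij_def)
  then have "?l \<otimes>\<^bsub>BijGroup (carrier G)\<^esub> ?r = compose (carrier G) ?l ?r"
    by (simp add: BijGroup_def)
  also have "\<dots> = (\<lambda>x\<in>carrier G. a \<otimes> x \<otimes> b)"
    using a b by (auto simp: compose_def restrict_def fun_eq_iff m_assoc)
  finally have "(\<lambda>x\<in>carrier G. a \<otimes> x \<otimes> b) = ?l \<otimes>\<^bsub>BijGroup (carrier G)\<^esub> ?r"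
    by simp
  moreover have "?l \<in> left_translations G (carrier G)" "?r \<in> right_translations G (carrier G)"
    using a b unfolding left_translations_def right_translations_def by blast+
  ultimately have "(\<lambda>x\<in>carrier G. a \<otimes> x \<otimes> b) \<in> two_sided_translations G (carrier G)"
    unfolding two_sided_translations_def set_mult_def by blast
  then show ?thesis
    using translations_subset by blast
qed

sublocale transitive_permutation_group "carrier G" K
proof
  fix x y assume "x \<in> carrier G" "y \<in> carrier G"
  then have "(\<lambda>g\<in>carrier G. (y \<otimes> inv x) \<otimes> g \<otimes> \<one>) x = y" "(\<lambda>g\<in>carrier G. (y \<otimes> inv x) \<otimes> g \<otimes> \<one>) \<in> K"
    by (simp add: m_assoc, intro translation_mem) auto
  then show "\<exists>f\<in>K. f x = y"
    by blast
qed

text \<open>The general block argument with the whole group as \<open>L\<close> and with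
  \<open>K\<close> as \<open>H\<close>.\<close>

lemma socle_subset_block:
  assumes "imprimitivity_block (carrier G) K B" "\<one> \<in> B" "B \<noteq> {\<one>}"
  shows "socle G \<subseteq> B"
  using assms almost_simple_socle_subset_block[OF finite_carrier almost_simple subgroup_self]
    translation_mem normal_carrier_subset[OF socle_normal]
  by (auto simp: imprimitivity_block_def)

lemma socle_nontrivial: obtains c where "c \<in> socle G" "c \<noteq> \<one>"
proof -
  interpret S: simple_group "G\<lparr>carrier := socle G\<rparr>"
    using almost_simple by (simp add: almost_simple_def)
  have "socle G \<noteq> {\<one>}"
    using S.simple_not_triv by simp
  then show thesis
    using that S.one_closed by auto
qed

section \<open>The minimal block and its cosets\<close>

lemma carrier_block: "imprimitivity_block (carrier G) K (carrier G)"
  using mem_bij_betw by (auto simp: imprimitivity_block_def bij_betw_def)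

text \<open>The family being intersected is nonempty, since it contains the whole group. All its
  members contain the socle, so the intersection is still nontrivial.\<close>

lemma minimal_block_facts:
  shows "imprimitivity_block (carrier G) K L" "\<one> \<in> L" "socle G \<subseteq> L"
    and minimal_block_least:
      "\<lbrakk>imprimitivity_block (carrier G) K B; \<one> \<in> B; B \<noteq> {\<one>}\<rbrakk> \<Longrightarrow> L \<subseteq> B"
proof -
  obtain c where "c \<in> socle G" "c \<noteq> \<one>"
    by (rule socle_nontrivial)
  then have "carrier G \<noteq> {\<one>}"
    using normal_carrier_subset[OF socle_normal] by blast
  then show "imprimitivity_block (carrier G) K L"
    unfolding minimal_block_def using mem_inj_on carrier_block
    by (intro imprimitivity_block_Inter[where x = \<one>]) auto
  show "socle G \<subseteq> L"
    using socle_subset_block unfolding minimal_block_def by blast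
qed (auto simp: minimal_block_def)

lemma minimal_block_carrier: "L \<subseteq> carrier G"
  using minimal_block_facts(1) by (simp add: imprimitivity_block_def)

lemma lower_system: "imprimitivity_system (carrier G) K \<LL>"
  unfolding lower_partition_def by (rule system_of_block_imprimitivity[OF minimal_block_facts(1)])

lemma minimal_block_lower: "L \<in> \<LL>"
  unfolding lower_partition_def by (rule system_of_block_self[OF minimal_block_carrier])

lemma lower_image: "k \<in> K \<Longrightarrow> X \<in> \<LL> \<Longrightarrow> k ` X \<in> \<LL>"
  using lower_system by (simp add: imprimitivity_system_def)

lemma lower_carrier: "X \<in> \<LL> \<Longrightarrow> X \<subseteq> carrier G"
  using lower_system by (auto simp: imprimitivity_system_def partition_on_def)

lemma lower_nonempty: "X \<in> \<LL> \<Longrightarrow> X \<noteq> {}"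
  using lower_system by (auto simp: imprimitivity_system_def partition_on_def)

lemma lower_cover: "x \<in> carrier G \<Longrightarrow> \<exists>X\<in>\<LL>. x \<in> X"
  using lower_system by (auto simp: imprimitivity_system_def partition_on_def)

lemma lower_unique: "\<lbrakk>X \<in> \<LL>; Y \<in> \<LL>; x \<in> X; x \<in> Y\<rbrakk> \<Longrightarrow> X = Y"
  using lower_system unfolding imprimitivity_system_def partition_on_def disjoint_def by blast

text \<open>Left and right multiplication by \<open>x\<close> both send \<open>\<one>\<close> to
  \<open>x\<close>, so both carry \<open>L\<close> onto the unique block through \<open>x\<close>.
  Hence each block is a left and a right coset of \<open>L\<close>.\<close>

lemma lower_mult_mem:
  assumes X: "X \<in> \<LL>" "x \<in> X" and l: "l \<in> L"
  shows "l \<otimes> x \<in> X" "x \<otimes> l \<in> X"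
proof -
  have xl: "x \<in> carrier G" "l \<in> carrier G"
    using X l lower_carrier minimal_block_carrier by blast+
  have "f ` L = X" if f: "f \<in> K" "f \<one> = x" for f
    using lower_unique[OF lower_image[OF f(1) minimal_block_lower] X(1) _ X(2)]
      f(2) minimal_block_facts(2) by blast
  then have sub: "f l \<in> X" if "f \<in> K" "f \<one> = x" for f
    using that l by blast
  show "l \<otimes> x \<in> X" "x \<otimes> l \<in> X"
    using sub[OF translation_mem[of \<one> x]] sub[OF translation_mem[of x \<one>]] xl by simp_all
qed

text \<open>Right multiplication by \<open>x^-1\<close> carries the block of \<open>x\<close> to the
  block of \<open>\<one>\<close>, which is \<open>L\<close>.\<close>

lemma lower_divide_mem:
  assumes X: "X \<in> \<LL>" "x \<in> X" "y \<in> X"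
  shows "y \<otimes> inv x \<in> L"
proof -
  have xy: "x \<in> carrier G" "y \<in> carrier G"
    using X lower_carrier by blast+
  let ?f = "\<lambda>g\<in>carrier G. \<one> \<otimes> g \<otimes> inv x"
  have f: "?f \<in> K" "?f x = \<one>" "?f y = y \<otimes> inv x"
    using xy translation_mem by simp_all
  then have "?f ` X = L"
    using lower_unique[OF lower_image[OF f(1) X(1)] minimal_block_lower _ minimal_block_facts(2)]
      X(2) by (metis imageI)
  then show ?thesis
    using f(3) X(3) by (metis imageI)
qed

lemma minimal_block_subgroup: "subgroup L G"
proof
  show "inv x \<in> L" if "x \<in> L" for x
    using lower_divide_mem[OF minimal_block_lower that minimal_block_facts(2)] that
      minimal_block_carrier by auto
qed (use minimal_block_carrier minimal_block_facts lower_mult_mem[OF minimal_block_lower] in auto)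

lemma mem_blockwise_stabilizerI:
  assumes f: "f \<in> K" and "\<And>X x. X \<in> \<LL> \<Longrightarrow> x \<in> X \<Longrightarrow> f x \<in> X"
  shows "f \<in> H"
proof -
  have "f ` X = X" if X: "X \<in> \<LL>" for X
  proof -
    obtain x where "x \<in> X"
      using lower_nonempty[OF X] by blast
    then show ?thesis
      using lower_unique[OF lower_image[OF f X] X, of "f x"] assms(2)[OF X] by blast
  qed
  then show ?thesis
    using f by (simp add: blockwise_stabilizer_def)
qed

text \<open>Blocks are cosets of \<open>L\<close> on both sides, so two-sided multiplication by
  elements of \<open>L\<close> does not leave them. This makes the socle argument available for
  blocks of \<open>H\<close>.\<close>

lemma translation_mem_blockwise_stabilizer:
  assumes "a \<in> L" "b \<in> L"
  shows "(\<lambda>x\<in>carrier G. a \<otimes> x \<otimes> b) \<in> H"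
proof (rule mem_blockwise_stabilizerI)
  show "(\<lambda>x\<in>carrier G. a \<otimes> x \<otimes> b) \<in> K"
    using assms minimal_block_carrier by (intro translation_mem) auto
  show "(\<lambda>x\<in>carrier G. a \<otimes> x \<otimes> b) x \<in> X" if "X \<in> \<LL>" "x \<in> X" for X x
    using lower_mult_mem(2)[OF that(1) lower_mult_mem(1)[OF that assms(1)] assms(2)]
      lower_carrier that by auto
qed

sublocale normal_permutation_subgroup "carrier G" K H
proof (intro normal_permutation_subgroup.intro normal_permutation_subgroup_axioms.intro)
  show "transitive_permutation_group (carrier G) K"
    by unfold_locales
  show "permutation_group (carrier G) H"
    using lower_carrier by (rule blockwise_stabilizer_permutation_group)
  show "finite (carrier G)"
    by (rule finite_carrier)
  show "H \<subseteq> K"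
    by (auto simp: blockwise_stabilizer_def)
  show "\<exists>h'\<in>H. \<forall>x\<in>carrier G. k (h x) = h' (k x)" if "k \<in> K" "h \<in> H" for k h
    using blockwise_stabilizer_conjugate[OF lower_system that] .
qed

section \<open>The kernel is primitive on each block\<close>

lemma stabilizer_image: "h \<in> H \<Longrightarrow> X \<in> \<LL> \<Longrightarrow> h ` X = X"
  by (simp add: blockwise_stabilizer_def)

lemma stabilizer_transitive:
  assumes "X \<in> \<LL>" "x \<in> X" "y \<in> X"
  shows "\<exists>h\<in>H. h x = y"
proof -
  have "(\<lambda>g\<in>carrier G. (y \<otimes> inv x) \<otimes> g \<otimes> \<one>) \<in> H"
    using lower_divide_mem[OF assms] minimal_block_facts(2)
    by (rule translation_mem_blockwise_stabilizer)
  moreover have "(\<lambda>g\<in>carrier G. (y \<otimes> inv x) \<otimes> g \<otimes> \<one>) x = y"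
    using assms lower_carrier by (auto simp: m_assoc subset_iff)
  ultimately show ?thesis
    by blast
qed

text \<open>Every nontrivial \<open>H\<close>-block in \<open>L\<close> through
  \<open>\<one>\<close> contains the socle, so any nontrivial socle element serves as the common
  point \<open>c\<close> of \<open>minimal_block_primitive\<close>.\<close>

lemma stabilizer_primitive:
  assumes B: "imprimitivity_block (carrier G) H B" "B \<subseteq> X" and X: "X \<in> \<LL>"
    and xy: "x \<in> B" "y \<in> B" "x \<noteq> y"
  shows "B = X"
proof -
  obtain c where c: "c \<in> socle G" "c \<noteq> \<one>"
    by (rule socle_nontrivial)
  show ?thesis
  proof (rule minimal_block_primitive[OF minimal_block_facts(1,2) _ c(2) _ _ _ B _ xy])
    show "B = L" if "imprimitivity_block (carrier G) K B" "\<one> \<in> B" "B \<noteq> {\<one>}" "B \<subseteq> L" for B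
      using minimal_block_least that by blast
    show "c \<in> B"
      if "imprimitivity_block (carrier G) H B" "\<one> \<in> B" "B \<noteq> {\<one>}" "B \<subseteq> L" for B
      using almost_simple_socle_subset_block[OF finite_carrier almost_simple
          minimal_block_subgroup minimal_block_facts(3) translation_mem_blockwise_stabilizer]
        that c(1) by blast
    show "imprimitivity_block (carrier G) H L"
      using minimal_block_carrier minimal_block_facts(2) stabilizer_image[OF _ minimal_block_lower]
      by (auto simp: imprimitivity_block_def)
    show "L \<noteq> {\<one>}"
      using c minimal_block_facts(3) by blast
    show "X \<in> system_of_block K L"
      using X by (simp add: lower_partition_def)
  qed
qed

section \<open>Linked and unlinked pairs of blocks\<close>

lemma linked_iff:
  assumes "X \<in> \<LL>" "X' \<in> \<LL>"
  shows "linked_blocks H X X' \<longleftrightarrow> (\<forall>h\<in>H. (\<forall>x\<in>X. h x = x) \<longleftrightarrow> (\<forall>x\<in>X'. h x = x))"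
  using assms lower_carrier stabilizer_image by (intro H.linked_blocks_iff) auto

text \<open>The orbit of \<open>z\<close> under the elements of \<open>H\<close> fixing
  \<open>X\<close> pointwise is an \<open>H\<close>-block inside \<open>X'\<close> containing the
  distinct points \<open>z\<close> and \<open>h z\<close>. By primitivity it is \<open>X'\<close>.
  If \<open>m\<close> and \<open>n\<close> send \<open>z\<close> to \<open>x\<close> and
  \<open>y\<close>, then \<open>n m^-1\<close> sends \<open>x\<close> to \<open>y\<close>.\<close>

lemma kernel_transitive:
  assumes X: "X \<in> \<LL>" "X' \<in> \<LL>" and h: "h \<in> H" "\<And>x. x \<in> X \<Longrightarrow> h x = x"
    and z: "z \<in> X'" "h z \<noteq> z" and xy: "x \<in> X'" "y \<in> X'"
  shows "\<exists>g\<in>H. (\<forall>x\<in>X. g x = x) \<and> g x = y"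
proof -
  let ?B = "{n z | n. n \<in> H \<and> (\<forall>x\<in>X. n x = x)}"
  have XS: "X \<subseteq> carrier G" "X' \<subseteq> carrier G"
    using X lower_carrier by auto
  have block: "imprimitivity_block (carrier G) H ?B"
    using finite_carrier XS z(1) stabilizer_image X
    by (intro H.pointwise_stabilizer_orbit_block) auto
  have sub_X': "?B \<subseteq> X'"
    using stabilizer_image[OF _ X(2)] z(1) by blast
  have "\<exists>n. z = n z \<and> n \<in> H \<and> (\<forall>x\<in>X. n x = x)"
    using H.id_mem XS z(1) by (intro exI[of _ "\<lambda>x\<in>carrier G. x"]) auto
  then have z_B: "z \<in> ?B"
    by simp
  have hz_B: "h z \<in> ?B"
    using h by blast
  have B_eq: "?B = X'"
    by (rule stabilizer_primitive[OF block sub_X' X(2) z_B hz_B z(2)[symmetric]])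
  obtain m where m: "m \<in> H" "\<And>x. x \<in> X \<Longrightarrow> m x = x" "x = m z"
    using xy(1)[folded B_eq] by blast
  obtain n where n: "n \<in> H" "\<And>x. x \<in> X \<Longrightarrow> n x = x" "y = n z"
    using xy(2)[folded B_eq] by blast
  obtain m' where m': "m' \<in> H" "\<And>x. x \<in> carrier G \<Longrightarrow> m' (m x) = x"
    using H.inverse_mem[OF m(1)] by blast
  have "compose (carrier G) n m' \<in> H"
    using n(1) m'(1) by (rule H.compose_mem)
  moreover have "compose (carrier G) n m' u = u" if "u \<in> X" for u
  proof -
    have "m' u = u"
      using m(2)[OF that] m'(2) that XS by (metis subsetD)
    then show ?thesis
      using that XS n(2) by (auto simp: compose_def)
  qed
  moreover have "m' x = z"
    unfolding m(3) using m'(2) XS z(1) by blast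
  then have "compose (carrier G) n m' x = y"
    using subsetD[OF XS(2) xy(1)] n(3) by (simp add: compose_def)
  ultimately show ?thesis
    by blast
qed

text \<open>Some element of \<open>H\<close> fixes exactly one of the two blocks pointwise, so the
  pointwise stabilizer of that block is transitive on the other. Any element moving the first point
  correctly can then be adjusted on the second block without disturbing the first.\<close>

lemma not_linked_transitive:
  assumes X: "X \<in> \<LL>" "X' \<in> \<LL>" "\<not> linked_blocks H X X'"
    and mem: "x \<in> X" "y \<in> X" "x' \<in> X'" "y' \<in> X'"
  shows "\<exists>h\<in>H. h x = y \<and> h x' = y'"
proof -
  \<comment> \<open>The case where the element fixes the first block; it is used a second time with
    the two blocks exchanged.\<close>
  have main: "\<exists>h\<in>H. h x = y \<and> h x' = y'"
    if X: "X \<in> \<LL>" "X' \<in> \<LL>" and mem: "x \<in> X" "y \<in> X" "x' \<in> X'" "y' \<in> X'"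
      and h: "h \<in> H" "\<forall>x\<in>X. h x = x" "z \<in> X'" "h z \<noteq> z"
    for X X' x y x' y' h z
  proof -
    obtain g where g: "g \<in> H" "g x = y"
      using stabilizer_transitive[OF X(1) mem(1,2)] by blast
    have "g x' \<in> X'"
      using stabilizer_image[OF g(1) X(2)] mem(3) by blast
    then obtain n where n: "n \<in> H" "\<forall>x\<in>X. n x = x" "n (g x') = y'"
      using kernel_transitive[OF X h(1) _ h(3,4) _ mem(4)] h(2) by blast
    have "compose (carrier G) n g x = y" "compose (carrier G) n g x' = y'"
      using g n mem X lower_carrier by (auto simp: compose_def)
    then show ?thesis
      using H.compose_mem[OF n(1) g(1)] by blast
  qed
  obtain h where h: "h \<in> H" "\<not> ((\<forall>x\<in>X. h x = x) \<longleftrightarrow> (\<forall>x\<in>X'. h x = x))"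
    using X linked_iff by blast
  show ?thesis
  proof (cases "\<forall>x\<in>X. h x = x")
    case True
    then obtain z where "z \<in> X'" "h z \<noteq> z"
      using h(2) by blast
    then show ?thesis
      using main[OF X(1,2) mem h(1) True] by blast
  next
    case False
    then obtain z where z: "z \<in> X" "h z \<noteq> z"
      by blast
    have "\<forall>x\<in>X'. h x = x"
      using h(2) False by blast
    then show ?thesis
      using main[OF X(2,1) mem(3,4,1,2) h(1) _ z] by blast
  qed
qed

lemma linked_image:
  assumes k: "k \<in> K" and X: "X \<in> \<LL>" "X' \<in> \<LL>" "linked_blocks H X X'"
  shows "linked_blocks H (k ` X) (k ` X')"
  unfolding linked_iff[OF lower_image[OF k X(1)] lower_image[OF k X(2)]]
proof
  fix h assume h: "h \<in> H"
  obtain k' where k': "k' \<in> K" "\<And>x. x \<in> carrier G \<Longrightarrow> k' (k x) = x" "\<And>x. x \<in> carrier G \<Longrightarrow> k (k' x) = x"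
    using inverse_mem[OF k] by blast
  obtain h' where h': "h' \<in> H" "\<And>x. x \<in> carrier G \<Longrightarrow> k' (h x) = h' (k' x)"
    using conjugate[OF k'(1) h] by blast
  have "h (k x) = k x \<longleftrightarrow> h' x = x" if "x \<in> carrier G" for x
    using that h'(2)[of "k x"] k' mem_closed[OF k] H.mem_closed[OF h] H.mem_closed[OF h'(1)]
    by metis
  then have "(\<forall>y\<in>k ` Z. h y = y) \<longleftrightarrow> (\<forall>x\<in>Z. h' x = x)" if "Z \<in> \<LL>" for Z
    using lower_carrier[OF that] by blast
  then show "(\<forall>y\<in>k ` X. h y = y) \<longleftrightarrow> (\<forall>y\<in>k ` X'. h y = y)"
    using X h'(1) linked_iff[OF X(1,2)] by simp
qed

lemma linked_refl: "X \<in> \<LL> \<Longrightarrow> linked_blocks H X X"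
  by (simp add: linked_iff)

lemma linked_sym: "\<lbrakk>X \<in> \<LL>; Y \<in> \<LL>; linked_blocks H X Y\<rbrakk> \<Longrightarrow> linked_blocks H Y X"
  by (simp add: linked_iff)

lemma linked_trans:
  "\<lbrakk>X \<in> \<LL>; Y \<in> \<LL>; Z \<in> \<LL>; linked_blocks H X Y; linked_blocks H Y Z\<rbrakk> \<Longrightarrow> linked_blocks H X Z"
  by (simp add: linked_iff)

section \<open>The top of the section and the partition into linkage classes\<close>

lemma section_top_eq: "U = \<Union>{X \<in> \<LL>. linked_blocks H L X}"
  by (simp add: section_top_def)

lemma subset_section_top_iff:
  assumes "X \<in> \<LL>"
  shows "X \<subseteq> U \<longleftrightarrow> linked_blocks H L X"
proof
  assume "X \<subseteq> U"
  then obtain x Z where "x \<in> X" "x \<in> Z" "Z \<in> \<LL>" "linked_blocks H L Z"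
    using lower_nonempty[OF assms] unfolding section_top_eq by blast
  then show "linked_blocks H L X"
    using lower_unique[OF assms] by blast
qed (use assms in \<open>auto simp: section_top_eq\<close>)

text \<open>If \<open>k U\<close> meets \<open>U\<close>, then \<open>k\<close> carries a block
  \<open>X\<close> linked to \<open>L\<close> onto a block \<open>X'\<close> linked to
  \<open>L\<close>. Thus \<open>k L\<close> is linked to \<open>k X = X'\<close> and so to
  \<open>L\<close>, and \<open>k\<close> maps the class of \<open>L\<close> into itself; finiteness
  gives equality.\<close>

lemma section_top_block: "imprimitivity_block (carrier G) K U"
  unfolding imprimitivity_block_def
proof (intro conjI ballI)
  show UG: "U \<subseteq> carrier G"
    using lower_carrier by (auto simp: section_top_eq)
  have "L \<subseteq> U"
    using subset_section_top_iff linked_refl minimal_block_lower by blast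
  then show "U \<noteq> {}"
    using minimal_block_facts(2) by blast
  fix k assume k: "k \<in> K"
  have "k ` U = U" if meet: "k ` U \<inter> U \<noteq> {}"
  proof (rule endo_inj_surj)
    show "finite U"
      using UG finite_carrier by (rule finite_subset)
    show "inj_on k U"
      using mem_inj_on[OF k] UG by (rule inj_on_subset)
    obtain u where u: "u \<in> U" "k u \<in> U"
      using meet by blast
    then obtain X X' where X: "X \<in> \<LL>" "linked_blocks H L X" "u \<in> X"
      and X': "X' \<in> \<LL>" "linked_blocks H L X'" "k u \<in> X'"
      unfolding section_top_eq by blast
    have "k ` X = X'"
      using lower_unique[OF lower_image[OF k X(1)] X'(1) _ X'(3)] X(3) by blast
    then have "linked_blocks H (k ` L) X'"
      using linked_image[OF k minimal_block_lower X(1,2)] by simp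
    then have kL: "linked_blocks H L (k ` L)"
      using linked_trans linked_sym lower_image[OF k] minimal_block_lower X' by metis
    have "k ` Z \<subseteq> U" if Z: "Z \<in> \<LL>" "linked_blocks H L Z" for Z
      using linked_trans[OF minimal_block_lower _ _ kL linked_image[OF k minimal_block_lower Z]]
        lower_image[OF k] minimal_block_lower Z(1) subset_section_top_iff by blast
    then show "k ` U \<subseteq> U"
      unfolding section_top_eq by blast
  qed
  then show "k ` U = U \<or> k ` U \<inter> U = {}"
    by blast
qed

lemma upper_system: "imprimitivity_system (carrier G) K \<UU>"
  unfolding upper_partition_def by (rule system_of_block_imprimitivity[OF section_top_block])

lemma upper_unique: "\<lbrakk>Y \<in> \<UU>; Y' \<in> \<UU>; x \<in> Y; x \<in> Y'\<rbrakk> \<Longrightarrow> Y = Y'"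
  using upper_system unfolding imprimitivity_system_def partition_on_def disjoint_def by blast

lemma lower_refines_upper:
  assumes "X \<in> \<LL>"
  shows "\<exists>Y\<in>\<UU>. X \<subseteq> Y"
proof -
  obtain k where "k \<in> K" "X = k ` L"
    using assms by (auto simp: lower_partition_def system_of_block_def)
  moreover have "L \<subseteq> U"
    using subset_section_top_iff linked_refl minimal_block_lower by blast
  ultimately show ?thesis
    by (auto simp: upper_partition_def system_of_block_def)
qed

text \<open>Translating \<open>Y\<close> back to \<open>U\<close> by \<open>k^-1\<close> preserves
  linkage, and inside \<open>U\<close> linkage to \<open>L\<close> is the definition.\<close>

lemma linked_iff_upper:
  assumes X: "X \<in> \<LL>" "X' \<in> \<LL>" and Y: "Y \<in> \<UU>" "X \<subseteq> Y"
  shows "linked_blocks H X X' \<longleftrightarrow> X' \<subseteq> Y"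
proof -
  obtain k where k: "k \<in> K" "Y = k ` U"
    using Y(1) by (auto simp: upper_partition_def system_of_block_def)
  obtain k' where k': "k' \<in> K" "\<And>x. x \<in> carrier G \<Longrightarrow> k' (k x) = x" "\<And>x. x \<in> carrier G \<Longrightarrow> k (k' x) = x"
    using inverse_mem[OF k(1)] by blast
  have UG: "U \<subseteq> carrier G"
    using section_top_block by (simp add: imprimitivity_block_def)
  have kk': "k ` k' ` Z = Z" if "Z \<in> \<LL>" for Z
    using k'(3) lower_carrier[OF that] by (intro image_image_inverse) auto
  have "k' ` k ` U = U"
    using k'(2) UG by (intro image_image_inverse) auto
  then have "k' ` Z \<subseteq> U \<longleftrightarrow> Z \<subseteq> Y" if "Z \<in> \<LL>" for Z
    using kk'[OF that] k(2) by (metis image_mono)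
  then have sub: "linked_blocks H L (k' ` Z) \<longleftrightarrow> Z \<subseteq> Y" if "Z \<in> \<LL>" for Z
    using that subset_section_top_iff[OF lower_image[OF k'(1) that]] by simp
  have LX: "linked_blocks H L (k' ` X)"
    using sub X(1) Y(2) by blast
  have "linked_blocks H X X' \<longleftrightarrow> linked_blocks H (k' ` X) (k' ` X')"
    using linked_image[OF k'(1) X] linked_image[OF k(1) lower_image[OF k'(1) X(1)] lower_image[OF k'(1) X(2)]]
      kk' X by auto
  also have "\<dots> \<longleftrightarrow> linked_blocks H L (k' ` X')"
    using LX linked_trans linked_sym lower_image[OF k'(1)] X minimal_block_lower by meson
  finally show ?thesis
    using sub X(2) by simp
qed

section \<open>Orbits of the kernel on points and on pairs\<close>

lemma point_orbits_stabilizer: "point_orbits (carrier G) H = \<LL>"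
proof -
  have orb: "{h x | h. h \<in> H} = X" if "X \<in> \<LL>" "x \<in> X" for X x
    using stabilizer_transitive[OF that] stabilizer_image[OF _ that(1)] that(2) by blast
  show ?thesis
    unfolding H.point_orbits_eq
  proof (intro equalityI subsetI)
    fix D assume "D \<in> {{h x | h. h \<in> H} | x. x \<in> carrier G}"
    then show "D \<in> \<LL>"
      using orb lower_cover by fastforce
  next
    fix X assume X: "X \<in> \<LL>"
    then obtain x where "x \<in> X"
      using lower_nonempty by blast
    then show "X \<in> {{h x | h. h \<in> H} | x. x \<in> carrier G}"
      using orb[OF X] lower_carrier[OF X] by blast
  qed
qed

lemma not_linked_pair_orbit:
  assumes "X \<in> \<LL>" "X' \<in> \<LL>" "\<not> linked_blocks H X X'" "x \<in> X" "x' \<in> X'"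
  shows "{(h x, h x') | h. h \<in> H} = X \<times> X'"
proof
  show "{(h x, h x') | h. h \<in> H} \<subseteq> X \<times> X'"
    using assms stabilizer_image by blast
  show "X \<times> X' \<subseteq> {(h x, h x') | h. h \<in> H}"
    using not_linked_transitive[OF assms(1-3,4) _ assms(5)] by fastforce
qed

text \<open>The orbit of a pair lies in a product \<open>X \<times> X'\<close> of blocks. If they
  are linked, they share a block of \<open>\<UU>\<close>; otherwise they lie in distinct ones and
  the orbit fills the whole product.\<close>

lemma pair_orbits_stabilizer:
  "pair_orbits (carrier G) H =
     {R \<in> pair_orbits (carrier G) H. \<exists>Y\<in>\<UU>. R \<subseteq> Y \<times> Y} \<union>
     {X \<times> X' | X X'. X \<in> \<LL> \<and> X' \<in> \<LL> \<and> (\<exists>Y\<in>\<UU>. \<exists>Y'\<in>\<UU>. Y \<noteq> Y' \<and> X \<subseteq> Y \<and> X' \<subseteq> Y')}"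
  (is "?O = ?A \<union> ?B")
proof
  show "?O \<subseteq> ?A \<union> ?B"
  proof
    fix R assume R: "R \<in> ?O"
    then obtain x x' where x: "x \<in> carrier G" "x' \<in> carrier G" "R = {(h x, h x') | h. h \<in> H}"
      unfolding H.pair_orbits_eq by blast
    then obtain X X' where X: "X \<in> \<LL>" "x \<in> X" and X': "X' \<in> \<LL>" "x' \<in> X'"
      using lower_cover by blast
    obtain Y Y' where Y: "Y \<in> \<UU>" "X \<subseteq> Y" and Y': "Y' \<in> \<UU>" "X' \<subseteq> Y'"
      using lower_refines_upper X X' by meson
    show "R \<in> ?A \<union> ?B"
    proof (cases "linked_blocks H X X'")
      case True
      then have "X' \<subseteq> Y"
        using linked_iff_upper[OF X(1) X'(1) Y] by simp
      then have "R \<subseteq> Y \<times> Y"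
        using x(3) Y(2) X X' stabilizer_image by blast
      then show ?thesis
        using R Y(1) by blast
    next
      case False
      then have "Y \<noteq> Y'"
        using linked_iff_upper[OF X(1) X'(1) Y] Y'(2) by blast
      moreover have "R = X \<times> X'"
        using not_linked_pair_orbit[OF X(1) X'(1) False X(2) X'(2)] x(3) by simp
      ultimately show ?thesis
        using X(1) X'(1) Y Y' by blast
    qed
  qed
  show "?A \<union> ?B \<subseteq> ?O"
  proof
    fix R assume "R \<in> ?A \<union> ?B"
    moreover have "R \<in> ?O" if R: "R \<in> ?B"
    proof -
      obtain X X' Y Y' where X: "X \<in> \<LL>" "X' \<in> \<LL>" "R = X \<times> X'"
        and Y: "Y \<in> \<UU>" "Y' \<in> \<UU>" "Y \<noteq> Y'" "X \<subseteq> Y" "X' \<subseteq> Y'"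
        using R by blast
      obtain x x' where x: "x \<in> X" "x' \<in> X'"
        using lower_nonempty X by blast
      have "\<not> X' \<subseteq> Y"
        using upper_unique[OF Y(1,2)] Y(3,5) x(2) by blast
      then have "\<not> linked_blocks H X X'"
        using linked_iff_upper[OF X(1,2) Y(1,4)] by simp
      then have "R = {(h x, h x') | h. h \<in> H}"
        using not_linked_pair_orbit[OF X(1,2) _ x] X(3) by simp
      then show ?thesis
        unfolding H.pair_orbits_eq using x lower_carrier X(1,2) by blast
    qed
    ultimately show "R \<in> ?O"
      by blast
  qed
qed

text \<open>On any two points a member of the product agrees with a single element of
  \<open>H\<close>, so 2-closedness puts it into \<open>K\<close>. It keeps every point in its block
  of \<open>\<LL>\<close>, hence lies in \<open>H\<close>.\<close>

lemma stabilizer_eq_blockwise_product: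
  assumes tc: "two_closed (carrier G) K"
  shows "H = blockwise_product (carrier G) H \<UU>"
proof
  show "H \<subseteq> blockwise_product (carrier G) H \<UU>"
    using H.mem_Bij by (auto simp: blockwise_product_def induced_def)
  show "blockwise_product (carrier G) H \<UU> \<subseteq> H"
  proof
    fix f assume "f \<in> blockwise_product (carrier G) H \<UU>"
    then have f: "f \<in> Bij (carrier G)" and ind: "\<And>Y. Y \<in> \<UU> \<Longrightarrow> restrict f Y \<in> induced H Y"
      by (auto simp: blockwise_product_def)
    have agree: "\<exists>h\<in>H. \<forall>y\<in>Y. f y = h y" if Y: "Y \<in> \<UU>" for Y
    proof -
      obtain h where "h \<in> H" "restrict f Y = restrict h Y"
        using ind[OF Y] by (auto simp: induced_def)
      then show ?thesis
        by (metis restrict_apply')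
    qed
    have block: "f x \<in> X" if X: "X \<in> \<LL>" "x \<in> X" for X x
    proof -
      obtain Y where "Y \<in> \<UU>" "X \<subseteq> Y"
        using lower_refines_upper[OF X(1)] by blast
      then obtain h where "h \<in> H" "f x = h x"
        using agree X(2) by blast
      then show ?thesis
        using stabilizer_image X by blast
    qed
    have "f \<in> K"
    proof (rule two_closed_mem[OF finite_carrier tc f])
      fix x x' assume "x \<in> carrier G" "x' \<in> carrier G"
      then obtain X X' where X: "X \<in> \<LL>" "x \<in> X" and X': "X' \<in> \<LL>" "x' \<in> X'"
        using lower_cover by blast
      obtain Y where Y: "Y \<in> \<UU>" "X \<subseteq> Y"
        using lower_refines_upper[OF X(1)] by blast
      have "\<exists>h\<in>H. f x = h x \<and> f x' = h x'"
      proof (cases "linked_blocks H X X'")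
        case True
        then have "X' \<subseteq> Y"
          using linked_iff_upper[OF X(1) X'(1) Y] by simp
        then show ?thesis
          using agree[OF Y(1)] Y(2) X(2) X'(2) by blast
      next
        \<comment> \<open>Here the pieces of \<open>f\<close> on the two blocks may come from
          different elements of \<open>H\<close>. As \<open>f x\<close> stays in \<open>X\<close>
          and \<open>f x'\<close> in \<open>X'\<close>, transitivity on \<open>X \<times> X'\<close>
          yields one element with both values.\<close>
        case False
        then show ?thesis
          using not_linked_transitive[OF X(1) X'(1) False X(2) block[OF X] X'(2) block[OF X']]
          by metis
      qed
      then show "\<exists>k\<in>K. f x = k x \<and> f x' = k x'"
        using sub by blast
    qed
    then show "f \<in> H"
      using block by (rule mem_blockwise_stabilizerI)
  qed
qed

end

theorem theorem4p4:
  fixes G :: "('a, 'b) monoid_scheme"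
    and K :: "('a \<Rightarrow> 'a) set"
    and \<LL> \<UU> :: "'a set set"
  assumes "group G" and "finite (carrier G)" and "almost_simple G"
    and "subgroup K (BijGroup (carrier G))"
    and "two_sided_translations G (carrier G) \<subseteq> K"
    and "two_closed (carrier G) K"
    and "\<LL> = lower_partition G K"
    and "\<UU> = upper_partition G K"
  shows "pair_orbits (carrier G) (blockwise_stabilizer K \<LL>) =
           {R \<in> pair_orbits (carrier G) (blockwise_stabilizer K \<LL>). \<exists>Y\<in>\<UU>. R \<subseteq> Y \<times> Y} \<union>
           {\<Delta> \<times> \<Delta>' | \<Delta> \<Delta>'.
              \<Delta> \<in> point_orbits (carrier G) (blockwise_stabilizer K \<LL>) \<and>
              \<Delta>' \<in> point_orbits (carrier G) (blockwise_stabilizer K \<LL>) \<and>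
              (\<exists>Y\<in>\<UU>. \<exists>Y'\<in>\<UU>. Y \<noteq> Y' \<and> \<Delta> \<subseteq> Y \<and> \<Delta>' \<subseteq> Y')} \<and>
         blockwise_stabilizer K \<LL> =
           blockwise_product (carrier G) (blockwise_stabilizer K \<LL>) \<UU> \<and>
         generalized_wreath_product (carrier G) K \<LL> \<UU>"
proof -
  interpret central_overgroup G K
    using assms by (simp add: central_overgroup_def central_overgroup_axioms_def permutation_group_def)
  have "generalized_wreath_product (carrier G) K (lower_partition G K) (upper_partition G K)"
    unfolding generalized_wreath_product_def
    using assms(4) transitive_actionI[OF transitive] lower_system upper_system lower_refines_upper
      stabilizer_eq_blockwise_product[OF assms(6)] by blast
  then show ?thesis
    unfolding assms(7,8) point_orbits_stabilizer
    using pair_orbits_stabilizer stabilizer_eq_blockwise_product[OF assms(6)] by blast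
qed

end
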